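(* There exists a polynomial time algorithm which, for a given digraph $D$ and a natural number $k$, either returns $k$ pairwise arc-disjoint spanning antistrong subdigraphs of $D$ or correctly answers that no such set of subdigraphs exists.
   Context: Digraphs are finite and loopless. In a walk (in the underlying graph) an arc $vw$ is forward if traversed from $v$ to $w$ and backward if traversed from $w$ to $v$. An antidirected trail is a walk with no repeated arc whose arcs alternate between forward and backward; it is a forward antidirected trail if it begins and ends with a forward arc. A digraph is antistrong if it has at least three vertices and contains a forward antidirected $(x,y)$-trail for every pair of distinct vertices $x,y$. *)

theory Defs
  imports
    "Graph_Theory.Digraph_Component"
    "HOL-Library.Log_Nat"
    "HOL-Computational_Algebra.Polynomial"
begin

section \<open>Antistrong digraphs\<close>

text \<open>
  Walks in the underlying graph are lists of traversed arcs, each tagged with whether it is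
  traversed forward, i.e. from its tail to its head.
\<close>

type_synonym 'b step = "'b \<times> bool"

fun step_source :: "('a, 'b) pre_digraph \<Rightarrow> 'b step \<Rightarrow> 'a" where
  "step_source D (a, fwd) = (if fwd then tail D a else head D a)"

fun step_target :: "('a, 'b) pre_digraph \<Rightarrow> 'b step \<Rightarrow> 'a" where
  "step_target D (a, fwd) = (if fwd then head D a else tail D a)"

fun underlying_walk :: "('a, 'b) pre_digraph \<Rightarrow> 'a \<Rightarrow> 'b step list \<Rightarrow> 'a \<Rightarrow> bool" where
  "underlying_walk D x [] y \<longleftrightarrow> x \<in> verts D \<and> x = y"
| "underlying_walk D x (s # w) y \<longleftrightarrow>
     fst s \<in> arcs D \<and> step_source D s = x \<and> underlying_walk D (step_target D s) w y"

definition antidirected_trail :: "('a, 'b) pre_digraph \<Rightarrow> 'a \<Rightarrow> 'b step list \<Rightarrow> 'a \<Rightarrow> bool" where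
  "antidirected_trail D x w y \<longleftrightarrow>
     underlying_walk D x w y \<and> distinct (map fst w) \<and>
     (\<forall>i. Suc i < length w \<longrightarrow> snd (w ! Suc i) \<noteq> snd (w ! i))"

definition forward_antidirected_trail ::
    "('a, 'b) pre_digraph \<Rightarrow> 'a \<Rightarrow> 'b step list \<Rightarrow> 'a \<Rightarrow> bool" where
  "forward_antidirected_trail D x w y \<longleftrightarrow>
     antidirected_trail D x w y \<and> w \<noteq> [] \<and> snd (hd w) \<and> snd (last w)"

definition antistrong :: "('a, 'b) pre_digraph \<Rightarrow> bool" where
  "antistrong D \<longleftrightarrow>
     3 \<le> card (verts D) \<and>
     (\<forall>x \<in> verts D. \<forall>y \<in> verts D. x \<noteq> y \<longrightarrow> (\<exists>w. forward_antidirected_trail D x w y))"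

definition antistrong_packing ::
    "('a, 'b) pre_digraph \<Rightarrow> nat \<Rightarrow> ('a, 'b) pre_digraph list \<Rightarrow> bool" where
  "antistrong_packing D k Hs \<longleftrightarrow>
     length Hs = k \<and>
     (\<forall>H \<in> set Hs. spanning H D \<and> antistrong H) \<and>
     (\<forall>i < k. \<forall>j < k. i \<noteq> j \<longrightarrow> arcs (Hs ! i) \<inter> arcs (Hs ! j) = {})"

section \<open>Random access machines\<close>

text \<open>
  Programs for the random access machine with addition, truncated subtraction and comparison
  (but no multiplication) under the uniform cost criterion, in structured form. The memory is
  divided into arrays; a program mentions only finitely many array names, so that this is the
  same as one array up to a fixed interleaving of addresses. Scalar variables are cells of
  arrays. Expressions are part of the program text, so charging one unit for evaluating an
  expression changes the running time by at most a constant factor depending on the program.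

  As multiplication is absent, the binary length of the numbers stored grows by at most a constant
  (depending on the program) in each step. Hence running times polynomial in the binary length
  of the input are the same, up to polynomials, as those of Turing machines.
\<close>

type_synonym array = string

datatype expr =
    Const nat
  | Read array expr
  | Plus expr expr
  | Minus expr expr

datatype cond =
    Less expr expr
  | Neg cond
  | Conj cond cond

datatype program =
    Skip
  | Write array expr expr
  | Seq program program
  | Branch cond program program
  | While cond program

type_synonym memory = "array \<Rightarrow> nat \<Rightarrow> nat"

primrec expr_val :: "expr \<Rightarrow> memory \<Rightarrow> nat" where
  "expr_val (Const n) s = n"
| "expr_val (Read a e) s = s a (expr_val e s)"
| "expr_val (Plus e f) s = expr_val e s + expr_val f s"
| "expr_val (Minus e f) s = expr_val e s - expr_val f s"

primrec cond_val :: "cond \<Rightarrow> memory \<Rightarrow> bool" where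
  "cond_val (Less e f) s \<longleftrightarrow> expr_val e s < expr_val f s"
| "cond_val (Neg b) s \<longleftrightarrow> \<not> cond_val b s"
| "cond_val (Conj b c) s \<longleftrightarrow> cond_val b s \<and> cond_val c s"

text \<open>\<open>exec P s t s'\<close>: started in memory \<open>s\<close>, \<open>P\<close> halts after \<open>t\<close> steps in memory \<open>s'\<close>.\<close>

inductive exec :: "program \<Rightarrow> memory \<Rightarrow> nat \<Rightarrow> memory \<Rightarrow> bool" where
  Skip: "exec Skip s 1 s"
| Write: "exec (Write a e f) s 1 (s(a := (s a)(expr_val e s := expr_val f s)))"
| Seq: "exec P s t s' \<Longrightarrow> exec Q s' u s'' \<Longrightarrow> exec (Seq P Q) s (t + u) s''"
| Branch_True: "cond_val b s \<Longrightarrow> exec P s t s' \<Longrightarrow> exec (Branch b P Q) s (1 + t) s'"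
| Branch_False: "\<not> cond_val b s \<Longrightarrow> exec Q s t s' \<Longrightarrow> exec (Branch b P Q) s (1 + t) s'"
| While_False: "\<not> cond_val b s \<Longrightarrow> exec (While b P) s 1 s"
| While_True: "cond_val b s \<Longrightarrow> exec P s t s' \<Longrightarrow> exec (While b P) s' u s'' \<Longrightarrow>
    exec (While b P) s (1 + t + u) s''"

inductive_cases exec_SkipE: "exec Skip s t s'"
inductive_cases exec_WriteE: "exec (Write a e f) s t s'"
inductive_cases exec_SeqE: "exec (Seq P Q) s t s'"
inductive_cases exec_BranchE: "exec (Branch b P Q) s t s'"
inductive_cases exec_WhileE: "exec (While b P) s t s'"

lemma exec_deterministic:
  "exec P s t s' \<Longrightarrow> exec P s u s'' \<Longrightarrow> u = t \<and> s'' = s'"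
proof (induction arbitrary: u s'' rule: exec.induct)
  case Skip
  then show ?case by (rule exec_SkipE) simp
next
  case Write
  then show ?case by (rule exec_WriteE) simp
next
  case Seq
  from Seq.prems show ?case by (rule exec_SeqE) (metis Seq.IH)
next
  case Branch_True
  from Branch_True.prems show ?case
    by (rule exec_BranchE) (metis Branch_True.IH Branch_True.hyps plus_1_eq_Suc add_Suc)+
next
  case Branch_False
  from Branch_False.prems show ?case
    by (rule exec_BranchE) (metis Branch_False.IH Branch_False.hyps plus_1_eq_Suc add_Suc)+
next
  case While_False
  from While_False.prems show ?case
    by (rule exec_WhileE) (simp_all add: While_False.hyps)
next
  case While_True
  from While_True.prems show ?case
    by (rule exec_WhileE) (metis While_True.IH While_True.hyps plus_1_eq_Suc add_Suc)+
qed

text \<open>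
  A list of numbers is stored in an array with its length in cell 0; all other cells are
  initially 0. The output is read from an array in the same format, and the time needed for
  reading it is counted.
\<close>

definition initial_memory :: "nat list \<Rightarrow> memory" where
  "initial_memory xs = (\<lambda>a i.
     if a = ''in'' then (if i = 0 then length xs else if i \<le> length xs then xs ! (i - 1) else 0)
     else 0)"

definition output_list :: "memory \<Rightarrow> nat list" where
  "output_list s = map (s ''out'') [1..<Suc (s ''out'' 0)]"

definition computes_within :: "program \<Rightarrow> nat list \<Rightarrow> nat \<Rightarrow> nat list \<Rightarrow> bool" where
  "computes_within P xs T ys \<longleftrightarrow>
     (\<exists>t s. exec P (initial_memory xs) t s \<and> output_list s = ys \<and> t + length ys \<le> T)"

text \<open>Each number is written in binary and followed by a separator.\<close>

definition input_size :: "nat list \<Rightarrow> nat" where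
  "input_size xs = (\<Sum>x\<leftarrow>xs. floorlog 2 x + 1)"

text \<open>
  A digraph is given by the numbers of its vertices and arcs, a list of its vertices, and a list
  of its arcs, each with its tail and head, in any order.
\<close>

definition digraph_code :: "(nat, nat) pre_digraph \<Rightarrow> nat list \<Rightarrow> bool" where
  "digraph_code D xs \<longleftrightarrow>
     (\<exists>vs as. distinct vs \<and> set vs = verts D \<and> distinct as \<and> set as = arcs D \<and>
        xs = [length vs, length as] @ vs @ concat (map (\<lambda>a. [a, tail D a, head D a]) as))"

end

theory Submission
  imports Defs
begin

text \<open>
  A digraph with at least three vertices is antistrong iff its bipartite representation, which has
  an edge from the first copy of \<open>v\<close> to the second copy of \<open>w\<close> for each arc \<open>vw\<close>, is connected: forward
  antidirected trails are trails from a first to a second copy. So the task is to find \<open>k\<close> disjoint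
  connected spanning subgraphs of a multigraph, i.e. \<open>k\<close> disjoint bases of its cycle matroid.

  This is done by a push-relabel algorithm for matroid partition in the style of Frank and
  Miklos. Disjoint independent sets \<open>F\<^sub>1, \<dots>, F\<^sub>k\<close> and levels between 0 and the number \<open>m\<close> of arcs are
  maintained such that, for \<open>L\<^sub>t\<close> the set of arcs of level at least \<open>t\<close>, every \<open>F\<^sub>i \<inter> L\<^sub>t\<close> spans
  \<open>L\<^sub>t\<^sub>+\<^sub>1\<close>. An uncovered arc of level less than \<open>m\<close> is inserted into some \<open>F\<^sub>i\<close>, or exchanged for an arc of
  lower level, or raised by one level; a potential quadratic in \<open>m\<close> decreases in each step. In the
  end all uncovered arcs have level \<open>m\<close>, so there is an empty level \<open>j < m\<close>, and \<open>S = L\<^sub>j = L\<^sub>j\<^sub>+\<^sub>1\<close>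
  contains all uncovered arcs and is spanned by each \<open>F\<^sub>i \<inter> S\<close>. Counting the arcs outside \<open>S\<close> then
  shows that the \<open>F\<^sub>i\<close> are bases if there are \<open>k\<close> disjoint bases at all.
\<close>

section \<open>Partitioning a matroid into independent sets\<close>

locale matroid_closure =
  fixes cl :: "'e set \<Rightarrow> 'e set"
  assumes cl_extensive: "X \<subseteq> cl X"
    and cl_mono: "X \<subseteq> Y \<Longrightarrow> cl X \<subseteq> cl Y"
    and cl_idem: "cl (cl X) \<subseteq> cl X"
    and cl_exchange: "y \<in> cl (insert x X) \<Longrightarrow> y \<notin> cl X \<Longrightarrow> x \<in> cl (insert y X)"
begin

lemma cl_subset: "X \<subseteq> cl Y \<Longrightarrow> cl X \<subseteq> cl Y"
  using cl_mono cl_idem by blast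

definition indep :: "'e set \<Rightarrow> bool" where
  "indep X \<longleftrightarrow> (\<forall>e\<in>X. e \<notin> cl (X - {e}))"

lemma indep_subset: "indep X \<Longrightarrow> Y \<subseteq> X \<Longrightarrow> indep Y"
  unfolding indep_def by (metis Diff_mono cl_mono order_refl subsetD)

text \<open>If \<open>e\<close> brought some \<open>f\<close> of \<open>X\<close> into the closure
  of the rest, exchange would put \<open>e\<close> into \<open>cl X\<close>.\<close>

lemma indep_insert:
  assumes "indep X" "e \<notin> cl X"
  shows "indep (insert e X)"
  unfolding indep_def
proof
  fix f assume f: "f \<in> insert e X"
  have e: "e \<notin> X" using assms(2) cl_extensive by blast
  show "f \<notin> cl (insert e X - {f})"
  proof (cases "f = e")
    case True
    then show ?thesis using e assms(2) by simp
  next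
    case False
    then have "f \<in> X" "insert e X - {f} = insert e (X - {f})" using f by auto
    moreover have "f \<notin> cl (X - {f})" using assms(1) \<open>f \<in> X\<close> by (simp add: indep_def)
    ultimately show ?thesis using cl_exchange[of f e "X - {f}"] assms(2)
      by (metis insert_Diff)
  qed
qed

text \<open>Add the elements of \<open>B\<close> to \<open>A\<close> one at a time: \<open>y\<close>
  is the one whose addition brings \<open>x\<close> into the closure, and \<open>C\<close> consists
  of those added before it. In this form \<open>cl_exchange\<close> applies.\<close>

lemma cl_critical:
  assumes "finite B" "x \<notin> cl A" "x \<in> cl (A \<union> B)"
  shows "\<exists>C y. C \<subseteq> B \<and> y \<in> B \<and> y \<notin> A \<union> C \<and> x \<notin> cl (A \<union> C) \<and> x \<in> cl (insert y (A \<union> C))"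
  using assms
proof (induction B rule: finite_induct)
  case empty
  then show ?case by simp
next
  case (insert b B)
  show ?case
  proof (cases "x \<in> cl (A \<union> B)")
    case True
    then show ?thesis using insert.IH insert.prems(1) by blast
  next
    case False
    then have "b \<notin> A \<union> B" using insert.prems(2) by (metis Un_insert_right insert_absorb)
    then show ?thesis using False insert.prems(2)
      by (intro exI[of _ B] exI[of _ b]) auto
  qed
qed

text \<open>Steinitz exchange: elements of \<open>J\<close> outside \<open>I\<close> are replaced by
  elements of \<open>I\<close> one at a time, keeping the size of \<open>J\<close> and the property
  that \<open>J\<close> spans \<open>I\<close>. An infinite \<open>I\<close> would have a subset of
  size \<open>Suc (card J)\<close> violating the bound.\<close>

lemma indep_card_le:
  assumes "finite J" "indep I" "I \<subseteq> cl J"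
  shows "finite I \<and> card I \<le> card J"
proof -
  have main: "card I \<le> card J"
    if "finite J" "finite I" "indep I" "I \<subseteq> cl J" for I J
    using that
  proof (induction "card (I - J)" arbitrary: J rule: less_induct)
    case less
    show ?case
    proof (cases "I \<subseteq> J")
      case True
      then show ?thesis using less.prems card_mono by blast
    next
      case False
      then obtain x where x: "x \<in> I" "x \<notin> J" by blast
      \<comment> \<open>The element \<open>y\<close> that leaves \<open>J\<close> is sought outside
        \<open>I\<close>: independence of \<open>I\<close> keeps \<open>x\<close> out of
        \<open>cl (J \<inter> I)\<close>, while \<open>x\<close> lies in
        \<open>cl J\<close>.\<close>
      have "x \<notin> cl (I - {x})" using x less.prems by (simp add: indep_def)
      then have "x \<notin> cl (J \<inter> I)" using cl_mono[of "J \<inter> I" "I - {x}"] x by blast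
      moreover have "x \<in> cl ((J \<inter> I) \<union> (J - I))" using x less.prems by (auto simp: Int_Diff_Un)
      ultimately obtain C y where C: "C \<subseteq> J - I" "y \<in> J - I" "y \<notin> J \<inter> I \<union> C"
          "x \<notin> cl (J \<inter> I \<union> C)" "x \<in> cl (insert y (J \<inter> I \<union> C))"
        using cl_critical[of "J - I" x "J \<inter> I"] less.prems(1) by blast
      define J' where "J' = insert x (J - {y})"
      have "y \<in> cl (insert x (J \<inter> I \<union> C))" using cl_exchange C by blast
      then have "y \<in> cl J'" using cl_mono[of "insert x (J \<inter> I \<union> C)" J'] C
        unfolding J'_def by blast
      moreover have "J - {y} \<subseteq> cl J'" using cl_extensive[of J'] unfolding J'_def by blast
      ultimately have "J \<subseteq> cl J'" by blast
      then have I: "I \<subseteq> cl J'" using less.prems cl_subset by blast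
      have "I - J' \<subset> I - J" using x C unfolding J'_def by blast
      then have "card (I - J') < card (I - J)" using less.prems by (simp add: psubset_card_mono)
      moreover have "finite J'" using less.prems by (simp add: J'_def)
      ultimately have "card I \<le> card J'" using less I by blast
      also have "card J' = card J" using C x less.prems(1) unfolding J'_def
        by (metis Diff_iff card.insert card_Suc_Diff1 finite_Diff)
      finally show ?thesis .
    qed
  qed
  have "finite I"
  proof (rule ccontr)
    assume "infinite I"
    then obtain I' where I': "I' \<subseteq> I" "finite I'" "card I' = Suc (card J)"
      using infinite_arbitrarily_large by blast
    then have "card I' \<le> card J" using main assms indep_subset by blast
    then show False using I' by simp
  qed
  then show ?thesis using main assms by blast
qed

end

text \<open>
  A colouring \<open>c\<close> assigns each element to one of the classes \<open>1, \<dots>, k\<close> or, as colour 0, to none.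
  By the condition on the levels \<open>l\<close>, the elements of level at least \<open>t + 1\<close> are spanned by those
  elements of class \<open>i\<close> that have level at least \<open>t\<close>, for every \<open>i\<close>.
\<close>

locale matroid_partition = matroid_closure cl for cl :: "'e set \<Rightarrow> 'e set" +
  fixes E :: "'e set"
  assumes finite_E: "finite E"
begin

definition colour_class :: "('e \<Rightarrow> nat) \<Rightarrow> nat \<Rightarrow> 'e set" where
  "colour_class c i = {e \<in> E. c e = i}"

definition valid :: "nat \<Rightarrow> ('e \<Rightarrow> nat) \<Rightarrow> ('e \<Rightarrow> nat) \<Rightarrow> bool" where
  "valid k c l \<longleftrightarrow> (\<forall>e\<in>E. c e \<le> k \<and> l e \<le> card E) \<and>
     (\<forall>i\<in>{1..k}. indep (colour_class c i) \<and>
        (\<forall>e\<in>E. 0 < l e \<longrightarrow> e \<in> cl {f \<in> colour_class c i. l e \<le> Suc (l f)}))"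

text \<open>The weights make every step pay: raising an uncovered element by one level changes its
  term by -2 + 1, covering it saves \<open>Suc (l e)\<close>, and an exchange trades
  \<open>Suc (l e)\<close> for the smaller \<open>Suc (l f)\<close>.\<close>

definition potential :: "('e \<Rightarrow> nat) \<Rightarrow> ('e \<Rightarrow> nat) \<Rightarrow> nat" where
  "potential c l = (\<Sum>e\<in>E. 2 * (card E - l e) + (if c e = 0 then Suc (l e) else 0))"

section \<open>The invariant: its start and the three kinds of step\<close>

lemma valid_initial: "(\<And>e. e \<in> E \<Longrightarrow> c e = 0 \<and> l e = 0) \<Longrightarrow> valid k c l"
  by (auto simp: valid_def colour_class_def indep_def)

lemma potential_initial:
  assumes "\<And>e. e \<in> E \<Longrightarrow> c e = 0 \<and> l e = 0"
  shows "potential c l = card E * (2 * card E + 1)"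
  using assms by (simp add: potential_def)

lemma potential_less:
  assumes "F \<subseteq> E"
    and "\<And>e. e \<in> E - F \<Longrightarrow> c' e = c e \<and> l' e = l e"
    and "(\<Sum>e\<in>F. 2 * (card E - l' e) + (if c' e = 0 then Suc (l' e) else 0)) <
      (\<Sum>e\<in>F. 2 * (card E - l e) + (if c e = 0 then Suc (l e) else 0))"
  shows "potential c' l' < potential c l"
proof -
  let ?p = "\<lambda>c l e. 2 * (card E - l e) + (if c e = 0 then Suc (l e) else 0 :: nat)"
  have "sum (?p c' l') (E - F) = sum (?p c l) (E - F)"
    using assms(2) by (intro sum.cong) auto
  then show ?thesis
    using assms(3) sum.subset_diff[OF assms(1) finite_E, of "?p c l"]
      sum.subset_diff[OF assms(1) finite_E, of "?p c' l'"]
    unfolding potential_def by linarith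
qed

text \<open>The classes only grow, so the spanning conditions persist by monotonicity.\<close>

lemma insert_step:
  assumes v: "valid k c l" and e: "e \<in> E" "c e = 0" and i: "i \<in> {1..k}"
    and n: "e \<notin> cl (colour_class c i)"
  shows "valid k (c(e := i)) l" "potential (c(e := i)) l < potential c l"
proof -
  have cls: "colour_class (c(e := i)) j = (if j = i then insert e (colour_class c j) else colour_class c j)"
    if "j \<in> {1..k}" for j
    using that e i by (auto simp: colour_class_def)
  have "d \<in> cl {f \<in> colour_class (c(e := i)) j. l d \<le> Suc (l f)}"
    if "j \<in> {1..k}" "d \<in> E" "0 < l d" for d j
  proof -
    have "d \<in> cl {f \<in> colour_class c j. l d \<le> Suc (l f)}" using v that by (auto simp: valid_def)
    moreover have "{f \<in> colour_class c j. l d \<le> Suc (l f)} \<subseteq> {f \<in> colour_class (c(e := i)) j. l d \<le> Suc (l f)}"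
      using cls[OF that(1)] by auto
    ultimately show ?thesis using cl_mono by blast
  qed
  moreover have "indep (colour_class (c(e := i)) j)" if "j \<in> {1..k}" for j
    using cls[OF that] v n that indep_insert by (auto simp: valid_def)
  ultimately show "valid k (c(e := i)) l" using v i by (auto simp: valid_def)
  show "potential (c(e := i)) l < potential c l"
    by (rule potential_less[of "{e}"]) (use e i in auto)
qed

text \<open>The set \<open>X\<close> certifies the exchange. Independence of the class shows that
  \<open>e\<close> is not spanned by the class without \<open>f\<close>; the level condition for
  \<open>e\<close> then forces \<open>l e = Suc (l f)\<close>, so the potential drops by exactly
  1.\<close>

lemma swap_step:
  assumes v: "valid k c l" and e: "e \<in> E" "c e = 0" and i: "i \<in> {1..k}"
    and f: "f \<in> colour_class c i" "f \<notin> X" "l f < l e"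
    and X: "X \<subseteq> colour_class c i" "e \<notin> cl X" "e \<in> cl (insert f X)"
  shows "valid k (c(e := i, f := 0)) l" "potential (c(e := i, f := 0)) l < potential c l"
proof -
  define c' where "c' = c(e := i, f := 0)"
  have ef: "e \<noteq> f" "f \<in> E" "c f = i" using e i f by (auto simp: colour_class_def)
  have cls: "colour_class c' j = (if j = i then insert e (colour_class c j - {f}) else colour_class c j)"
    if "j \<in> {1..k}" for j
    using that e i ef by (auto simp: colour_class_def c'_def)
  have fX: "f \<in> cl (insert e X)" using cl_exchange X by blast
  have nf: "f \<notin> cl (colour_class c i - {f})"
    using v i f by (auto simp: valid_def indep_def)
  have ne: "e \<notin> cl (colour_class c i - {f})"
  proof
    assume "e \<in> cl (colour_class c i - {f})"
    then have "insert e X \<subseteq> cl (colour_class c i - {f})"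
      using X(1) f(2) cl_extensive[of "colour_class c i - {f}"] by blast
    then show False using fX nf cl_subset by blast
  qed
  have ecl: "e \<in> cl {g \<in> colour_class c i. l e \<le> Suc (l g)}"
    using v i e f(3) by (auto simp: valid_def)
  have lf: "l e = Suc (l f)"
  proof (rule ccontr)
    assume "l e \<noteq> Suc (l f)"
    then have "{g \<in> colour_class c i. l e \<le> Suc (l g)} \<subseteq> colour_class c i - {f}" using f(3) by auto
    then show False using ecl ne cl_mono by blast
  qed
  have "d \<in> cl {g \<in> colour_class c' j. l d \<le> Suc (l g)}" if j: "j \<in> {1..k}" and d: "d \<in> E" "0 < l d" for d j
  proof -
    let ?A = "{g \<in> colour_class c j. l d \<le> Suc (l g)}" and ?B = "{g \<in> colour_class c' j. l d \<le> Suc (l g)}"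
    \<comment> \<open>A threshold set that loses \<open>f\<close> gains \<open>e\<close>, which has
      the higher level. It still spans \<open>f\<close> by exchange, as \<open>e\<close> lies in the
      closure of \<open>?A\<close> but not in that of \<open>?A - {f}\<close>.\<close>
    have "?A \<subseteq> cl ?B"
    proof (cases "j = i \<and> l d \<le> Suc (l f)")
      case False
      then have "?A \<subseteq> ?B" using cls[OF j] by auto
      then show ?thesis using cl_extensive by blast
    next
      case True
      then have B: "?B = insert e (?A - {f})"
        using cls[OF j] lf by auto
      have "{g \<in> colour_class c i. l e \<le> Suc (l g)} \<subseteq> ?A" using True lf by auto
      then have "e \<in> cl ?A" using ecl cl_mono by blast
      moreover have "?A = insert f (?A - {f})" using True f by auto
      moreover have "e \<notin> cl (?A - {f})"
        using ne True cl_mono[of "?A - {f}" "colour_class c i - {f}"] by auto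
      ultimately have "f \<in> cl ?B" using cl_exchange[of e f "?A - {f}"] B by metis
      moreover have "?A - {f} \<subseteq> cl ?B" using B cl_extensive[of ?B] by blast
      ultimately show ?thesis by blast
    qed
    moreover have "d \<in> cl ?A" using v j d by (auto simp: valid_def)
    ultimately show ?thesis using cl_subset by blast
  qed
  moreover have "indep (colour_class c' j)" if "j \<in> {1..k}" for j
  proof (cases "j = i")
    case True
    have "indep (colour_class c i - {f})" using v i by (auto simp: valid_def intro: indep_subset[of "colour_class c i"])
    then show ?thesis using cls[OF that] ne True indep_insert by simp
  qed (use cls[OF that] v that in \<open>auto simp: valid_def\<close>)
  ultimately show "valid k (c(e := i, f := 0)) l"
    using v i unfolding c'_def[symmetric] by (auto simp: valid_def c'_def)
  show "potential (c(e := i, f := 0)) l < potential c l"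
    by (rule potential_less[of "{e, f}"]) (use e ef i lf in auto)
qed

text \<open>Assumption \<open>r\<close> is the spanning condition for \<open>e\<close> at its new
  level, and raising \<open>e\<close> shrinks no threshold set of another element. The bound
  \<open>l e < card E\<close> makes the truncated difference in the potential really drop.\<close>

lemma relabel_step:
  assumes v: "valid k c l" and e: "e \<in> E" "c e = 0" "l e < card E"
    and r: "\<And>i. i \<in> {1..k} \<Longrightarrow> e \<in> cl {f \<in> colour_class c i. l e \<le> l f}"
  shows "valid k c (l(e := Suc (l e)))" "potential c (l(e := Suc (l e))) < potential c l"
proof -
  define l' where "l' = l(e := Suc (l e))"
  have "d \<in> cl {f \<in> colour_class c j. l' d \<le> Suc (l' f)}" if j: "j \<in> {1..k}" and d: "d \<in> E" "0 < l' d" for d j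
  proof (cases "d = e")
    case True
    have "{f \<in> colour_class c j. l e \<le> l f} \<subseteq> {f \<in> colour_class c j. l' d \<le> Suc (l' f)}"
      using True by (auto simp: l'_def)
    then show ?thesis using r[OF j] True cl_mono by blast
  next
    case False
    have "d \<in> cl {f \<in> colour_class c j. l d \<le> Suc (l f)}"
      using v j d False by (auto simp: valid_def l'_def)
    moreover have "{f \<in> colour_class c j. l d \<le> Suc (l f)} \<subseteq> {f \<in> colour_class c j. l' d \<le> Suc (l' f)}"
      using False by (auto simp: l'_def)
    ultimately show ?thesis using cl_mono by blast
  qed
  then show "valid k c (l(e := Suc (l e)))"
    using v e unfolding l'_def[symmetric] by (auto simp: valid_def l'_def)
  show "potential c (l(e := Suc (l e))) < potential c l"
    by (rule potential_less[of "{e}"]) (use e in auto)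
qed

section \<open>Optimality when no step is possible\<close>

lemma valid_closed_set:
  assumes v: "valid k c l" and stuck: "\<And>e. e \<in> E \<Longrightarrow> c e = 0 \<Longrightarrow> card E \<le> l e"
  shows "\<exists>S \<subseteq> E. {e \<in> E. c e = 0} \<subseteq> S \<and> (\<forall>i\<in>{1..k}. S \<subseteq> cl (colour_class c i \<inter> S))"
proof (cases "\<exists>e\<in>E. c e = 0")
  case False
  then show ?thesis by (intro exI[of _ "{}"]) auto
next
  case True
  then obtain e where e: "e \<in> E" "c e = 0" by blast
  \<comment> \<open>Pigeonhole: the elements other than \<open>e\<close> are too few to occupy all
    \<open>card E\<close> levels below \<open>card E\<close>, and \<open>e\<close> itself has level
    at least \<open>card E\<close>.\<close>
  have "card (l ` (E - {e})) \<le> card (E - {e})" using finite_E by (simp add: card_image_le)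
  also have "\<dots> < card {..<card E}" using card_Diff1_less[OF finite_E e(1)] by simp
  finally have "\<not> {..<card E} \<subseteq> l ` (E - {e})"
    using finite_E by (metis card_mono finite_Diff finite_imageI not_le)
  then obtain j where j: "j < card E" "j \<notin> l ` (E - {e})" by blast
  then have j': "l f \<noteq> j" if "f \<in> E" for f
    using that stuck[OF e] by (cases "f = e") auto
  define S where "S = {f \<in> E. j < l f}"
  have "S \<subseteq> cl (colour_class c i \<inter> S)" if i: "i \<in> {1..k}" for i
  proof
    fix f assume f: "f \<in> S"
    then have "f \<in> cl {g \<in> colour_class c i. l f \<le> Suc (l g)}"
      using v i by (auto simp: valid_def S_def)
    \<comment> \<open>Here \<open>l g\<close> is at least \<open>j\<close>, and level
      \<open>j\<close> is empty.\<close>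
    moreover have "{g \<in> colour_class c i. l f \<le> Suc (l g)} \<subseteq> colour_class c i \<inter> S"
      using f j' by (force simp: S_def colour_class_def)
    ultimately show "f \<in> cl (colour_class c i \<inter> S)" using cl_mono by blast
  qed
  moreover have "{e \<in> E. c e = 0} \<subseteq> S" using stuck j(1) by (force simp: S_def)
  ultimately show ?thesis by (intro exI[of _ S]) (auto simp: S_def)
qed

text \<open>
  Outside a closed set \<open>S\<close> containing all uncovered elements, spanning sets need at least as
  many elements as the classes, which use up all of them.
\<close>

lemma valid_optimal:
  assumes v: "valid k c l" and stuck: "\<And>e. e \<in> E \<Longrightarrow> c e = 0 \<Longrightarrow> card E \<le> l e"
    and T: "\<And>i. i \<in> {1..k} \<Longrightarrow> T i \<subseteq> E \<and> E \<subseteq> cl (T i)"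
    and disj: "\<And>i j. i \<in> {1..k} \<Longrightarrow> j \<in> {1..k} \<Longrightarrow> i \<noteq> j \<Longrightarrow> T i \<inter> T j = {}"
    and j: "j \<in> {1..k}"
  shows "E \<subseteq> cl (colour_class c j)"
proof (rule ccontr)
  assume "\<not> E \<subseteq> cl (colour_class c j)"
  then obtain x where x: "x \<in> E" "x \<notin> cl (colour_class c j)" by blast
  obtain S where S: "S \<subseteq> E" "{e \<in> E. c e = 0} \<subseteq> S"
      "\<And>i. i \<in> {1..k} \<Longrightarrow> S \<subseteq> cl (colour_class c i \<inter> S)"
    using valid_closed_set[OF v stuck] by blast
  have fin: "finite X" if "X \<subseteq> E" for X using that finite_E finite_subset by blast
  have cE: "colour_class c i \<subseteq> E" for i by (auto simp: colour_class_def)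
  \<comment> \<open>The part of \<open>T i\<close> inside \<open>S\<close> may be replaced by the
    class elements in \<open>S\<close>, since these span \<open>S\<close>.\<close>
  have span: "E \<subseteq> cl ((colour_class c i \<inter> S) \<union> (T i - S))" if i: "i \<in> {1..k}" for i
  proof -
    have "S \<subseteq> cl ((colour_class c i \<inter> S) \<union> (T i - S))" using S(3)[OF i] cl_mono by blast
    then have "T i \<subseteq> cl ((colour_class c i \<inter> S) \<union> (T i - S))"
      using cl_extensive[of "(colour_class c i \<inter> S) \<union> (T i - S)"] by blast
    then show ?thesis using T[OF i] cl_subset by blast
  qed
  have bound: "card I \<le> card (colour_class c i \<inter> S) + card (T i - S)"
    if "i \<in> {1..k}" "indep I" "I \<subseteq> E" for i I
  proof -
    have "card I \<le> card ((colour_class c i \<inter> S) \<union> (T i - S))"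
      using indep_card_le[of _ I] span that T fin cE
      by (metis (no_types, lifting) Diff_subset finite_Un infinite_super inf_le1 order_trans)
    then show ?thesis using card_Un_le order_trans by blast
  qed
  have split: "card (colour_class c i) = card (colour_class c i \<inter> S) + card (colour_class c i - S)" for i
    using fin[OF cE[of i]] by (metis card_Diff_subset_Int card_mono fin finite_Int inf_le1 le_add_diff_inverse)
  have le: "card (colour_class c i - S) \<le> card (T i - S)" if "i \<in> {1..k}" for i
    using bound[OF that, of "colour_class c i"] split[of i] v that cE by (auto simp: valid_def)
  \<comment> \<open>At \<open>j\<close> the class stays independent with \<open>x\<close> added,
    which makes the inequality strict.\<close>
  have "indep (insert x (colour_class c j))" using v j x indep_insert by (auto simp: valid_def)
  then have "card (insert x (colour_class c j)) \<le> card (colour_class c j \<inter> S) + card (T j - S)"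
    using bound[OF j] x cE by blast
  moreover have "x \<notin> colour_class c j" using x cl_extensive by blast
  ultimately have lt: "card (colour_class c j - S) < card (T j - S)"
    using split[of j] fin[OF cE[of j]] by simp
  have "(\<Sum>i\<in>{1..k}. card (colour_class c i - S)) < (\<Sum>i\<in>{1..k}. card (T i - S))"
    using le lt j by (intro sum_strict_mono_ex1) auto
  also have "\<dots> = card (\<Union>i\<in>{1..k}. T i - S)"
  proof (rule card_UN_disjoint[symmetric])
    show "\<forall>i\<in>{1..k}. finite (T i - S)" using T fin by blast
    show "\<forall>i\<in>{1..k}. \<forall>j\<in>{1..k}. i \<noteq> j \<longrightarrow> (T i - S) \<inter> (T j - S) = {}" using disj by blast
  qed simp
  also have "\<dots> \<le> card (\<Union>i\<in>{1..k}. colour_class c i - S)"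
  proof (rule card_mono)
    show "finite (\<Union>i\<in>{1..k}. colour_class c i - S)" using cE by (intro fin) auto
    show "(\<Union>i\<in>{1..k}. T i - S) \<subseteq> (\<Union>i\<in>{1..k}. colour_class c i - S)"
    proof
      fix e assume "e \<in> (\<Union>i\<in>{1..k}. T i - S)"
      then have e: "e \<in> E" "e \<notin> S" using T by blast+
      then have "c e \<in> {1..k}" using S(2) v by (force simp: valid_def)
      then show "e \<in> (\<Union>i\<in>{1..k}. colour_class c i - S)" using e by (auto simp: colour_class_def)
    qed
  qed
  also have "\<dots> = (\<Sum>i\<in>{1..k}. card (colour_class c i - S))"
    using fin cE by (intro card_UN_disjoint) (auto simp: colour_class_def)
  finally show False by simp
qed

end

section \<open>The bipartite representation\<close>

locale edge_ends =
  fixes u w :: "'e \<Rightarrow> 'v"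
begin

definition adj :: "'e set \<Rightarrow> ('v \<times> 'v) set" where
  "adj X = (\<lambda>e. (u e, w e)) ` X \<union> (\<lambda>e. (w e, u e)) ` X"

definition conn :: "'e set \<Rightarrow> 'v \<Rightarrow> 'v \<Rightarrow> bool" where
  "conn X p q \<longleftrightarrow> (p, q) \<in> (adj X)\<^sup>*"

lemma conn_refl [simp]: "conn X p p"
  by (simp add: conn_def)

lemma conn_sym: "conn X p q \<Longrightarrow> conn X q p"
proof -
  have "sym (adj X)" by (auto simp: sym_def adj_def)
  then show "conn X p q \<Longrightarrow> conn X q p"
    unfolding conn_def by (meson sym_rtrancl symD)
qed

lemma conn_trans: "conn X p q \<Longrightarrow> conn X q r \<Longrightarrow> conn X p r"
  by (auto simp: conn_def)

lemma conn_edge: "e \<in> X \<Longrightarrow> conn X (u e) (w e)"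
  by (auto simp: conn_def adj_def)

lemma conn_mono: "X \<subseteq> Y \<Longrightarrow> conn X p q \<Longrightarrow> conn Y p q"
  unfolding conn_def adj_def using rtrancl_mono by (metis (no_types, lifting) Un_mono image_mono subsetD)

lemma conn_empty: "conn {} p q \<longleftrightarrow> p = q"
  by (simp add: conn_def adj_def)

lemma conn_least:
  assumes "conn X p q" "\<And>e. e \<in> X \<Longrightarrow> conn Y (u e) (w e)"
  shows "conn Y p q"
  using assms(1) unfolding conn_def[of X]
proof (induction rule: rtrancl_induct)
  case (step q r)
  then have "conn Y q r" using assms(2) conn_sym by (auto simp: adj_def)
  then show ?case using step.IH conn_trans by blast
qed simp

text \<open>For fixed \<open>p\<close> the right-hand side is preserved along each edge: a walk that
  uses \<open>e\<close> repeatedly can be shortened to one using it at most once.\<close>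

lemma conn_insert:
  "conn (insert e X) p q \<longleftrightarrow>
     conn X p q \<or> (conn X p (u e) \<and> conn X (w e) q) \<or> (conn X p (w e) \<and> conn X (u e) q)"
    (is "?l \<longleftrightarrow> ?r q")
proof
  assume ?l
  then show "?r q" unfolding conn_def[of "insert e X"]
  proof (induction rule: rtrancl_induct)
    case (step q r)
    then consider "conn X q r" | "q = u e" "r = w e" | "q = w e" "r = u e"
      using conn_edge conn_sym by (auto simp: adj_def)
    then show ?case using step.IH by cases (use conn_trans conn_refl in blast)+
  qed simp
next
  assume "?r q"
  moreover have "conn (insert e X) p' q'" if "conn X p' q'" for p' q'
    using that conn_mono by blast
  moreover have "conn (insert e X) (u e) (w e)" "conn (insert e X) (w e) (u e)"
    using conn_edge conn_sym by blast+
  ultimately show ?l using conn_trans by blast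
qed

text \<open>The closure operator of the cycle matroid.\<close>

definition span :: "'e set \<Rightarrow> 'e set" where
  "span X = {e. conn X (u e) (w e)}"

lemma conn_span_subset: "X \<subseteq> span Y \<Longrightarrow> conn X p q \<Longrightarrow> conn Y p q"
  using conn_least[of X p q Y] unfolding span_def by blast

sublocale matroid_closure span
proof
  show "X \<subseteq> span X" for X using conn_edge by (auto simp: span_def)
  show "span X \<subseteq> span Y" if "X \<subseteq> Y" for X Y
    using that conn_mono by (auto simp: span_def)
  show "span (span X) \<subseteq> span X" for X
    using conn_span_subset[of "span X" X] by (auto simp: span_def)
  \<comment> \<open>The ends of \<open>y\<close> are connected only through \<open>x\<close>, so
    each is joined to an end of \<open>x\<close>; adding \<open>y\<close> instead therefore connects
    the ends of \<open>x\<close>.\<close>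
  show "x \<in> span (insert y X)" if "y \<in> span (insert x X)" "y \<notin> span X" for x y X
    using that conn_insert conn_sym unfolding span_def by (metis mem_Collect_eq)
qed

end

text \<open>
  The bipartite representation of a digraph: each vertex is split into a copy marked \<open>True\<close>,
  where arcs start, and a copy marked \<open>False\<close>, where arcs end. Antidirected walks are its walks.
\<close>

abbreviation bip_source :: "('a, 'b) pre_digraph \<Rightarrow> 'b \<Rightarrow> 'a \<times> bool" where
  "bip_source D a \<equiv> (tail D a, True)"

abbreviation bip_target :: "('a, 'b) pre_digraph \<Rightarrow> 'b \<Rightarrow> 'a \<times> bool" where
  "bip_target D a \<equiv> (head D a, False)"

abbreviation bip_conn :: "('a, 'b) pre_digraph \<Rightarrow> 'b set \<Rightarrow> 'a \<times> bool \<Rightarrow> 'a \<times> bool \<Rightarrow> bool" where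
  "bip_conn D \<equiv> edge_ends.conn (bip_source D) (bip_target D)"

definition bip_connected :: "('a, 'b) pre_digraph \<Rightarrow> 'b set \<Rightarrow> bool" where
  "bip_connected D X \<longleftrightarrow> (\<forall>p \<in> verts D \<times> UNIV. \<forall>q \<in> verts D \<times> UNIV. bip_conn D X p q)"

text \<open>The mark of the current copy fixes the direction of the next step, so alternation is
  built in. Arcs may still be repeated.\<close>

fun bip_walk :: "('a, 'b) pre_digraph \<Rightarrow> 'a \<times> bool \<Rightarrow> 'b step list \<Rightarrow> 'a \<times> bool \<Rightarrow> bool" where
  "bip_walk D p [] q \<longleftrightarrow> p = q"
| "bip_walk D p (s # w) q \<longleftrightarrow> fst s \<in> arcs D \<and> p = (step_source D s, snd s) \<and>
     bip_walk D (step_target D s, \<not> snd s) w q"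

section \<open>Bipartite walks and antidirected trails\<close>

lemma bip_walk_append:
  "bip_walk D p (w @ w') q \<longleftrightarrow> (\<exists>r. bip_walk D p w r \<and> bip_walk D r w' q)"
  by (induction w arbitrary: p) auto

lemma bip_conn_imp_walk:
  assumes "bip_conn D (arcs D) p q"
  shows "\<exists>w. bip_walk D p w q"
  using assms unfolding edge_ends.conn_def
proof (induction rule: converse_rtrancl_induct)
  case base
  then show ?case by (metis bip_walk.simps(1))
next
  case (step p r)
  then obtain w where w: "bip_walk D r w q" by blast
  from step.hyps(1) obtain a where "a \<in> arcs D"
      "(p, r) = (bip_source D a, bip_target D a) \<or> (p, r) = (bip_target D a, bip_source D a)"
    by (auto simp: edge_ends.adj_def)
  then have "bip_walk D p ((a, True) # w) q \<or> bip_walk D p ((a, False) # w) q"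
    using w by auto
  then show ?case by blast
qed

lemma bip_walk_imp_conn: "bip_walk D p w q \<Longrightarrow> bip_conn D (arcs D) p q"
proof (induction w arbitrary: p)
  case Nil
  then show ?case by (simp add: edge_ends.conn_refl)
next
  case (Cons s w)
  obtain a d where s: "s = (a, d)" by fastforce
  have "bip_conn D (arcs D) (bip_source D a) (bip_target D a)"
    using Cons.prems s by (intro edge_ends.conn_edge) auto
  then have "bip_conn D (arcs D) p (step_target D s, \<not> snd s)"
    using Cons.prems s edge_ends.conn_sym by (cases d) fastforce+
  then show ?case using Cons edge_ends.conn_trans by fastforce
qed

text \<open>In a shortest walk no arc is repeated: otherwise the part in between could be cut out.\<close>

lemma bip_walk_imp_trail:
  assumes "bip_walk D p w q"
  shows "\<exists>w. bip_walk D p w q \<and> distinct (map fst w)"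
  using assms
proof (induction w rule: length_induct)
  case (1 w)
  show ?case
  proof (cases "distinct (map fst w)")
    case False
    then obtain xs ys zs a where "map fst w = xs @ [a] @ ys @ [a] @ zs"
      using not_distinct_decomp by blast
    then obtain w1 r1 where w1: "w = w1 @ r1" "map fst r1 = a # ys @ a # zs"
      by (auto simp: map_eq_append_conv)
    then obtain d r2 where r2: "r1 = (a, d) # r2" "map fst r2 = ys @ a # zs"
      by (cases r1) auto
    then obtain w2 r3 where w2: "r2 = w2 @ r3" "map fst r3 = a # zs"
      by (auto simp: map_eq_append_conv)
    then obtain d' w3 where "r3 = (a, d') # w3"
      by (cases r3) auto
    then have w: "w = w1 @ [(a, d)] @ w2 @ [(a, d')] @ w3" using w1 r2 w2 by simp
    \<comment> \<open>If \<open>a\<close> is traversed twice in the same direction, the second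
      occurrence can take the place of the first; if in opposite directions, both occurrences and
      the part between them are dropped.\<close>
    have "bip_walk D p (w1 @ (a, d') # w3) q \<or> bip_walk D p (w1 @ w3) q"
      using "1.prems" unfolding w bip_walk_append by (cases d; cases d') auto
    moreover have "length (w1 @ (a, d') # w3) < length w" "length (w1 @ w3) < length w"
      by (simp_all add: w)
    ultimately show ?thesis using "1.IH" by blast
  qed (use "1.prems" in blast)
qed

lemma bip_walk_iff_underlying:
  assumes "wf_digraph D"
  shows "bip_walk D (x, True) w (y, False) \<and> distinct (map fst w) \<longleftrightarrow>
     forward_antidirected_trail D x w y"
proof -
  \<comment> \<open>Generalised over the direction \<open>d\<close> of the first step for the
    induction. The end mark \<open>False\<close> says that the last step is forward; well-formedness
    yields the vertex condition in the base case of \<open>underlying_walk\<close>.\<close>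
  have *: "bip_walk D (x, d) (s # w) (y, False) \<longleftrightarrow>
      underlying_walk D x (s # w) y \<and> snd s = d \<and> snd (last (s # w)) \<and>
      (\<forall>i. Suc i < length (s # w) \<longrightarrow> snd ((s # w) ! Suc i) \<noteq> snd ((s # w) ! i))" for d s w
  proof (induction w arbitrary: x d s)
    case Nil
    obtain a b where s: "s = (a, b)" by fastforce
    then show ?case using wf_digraph.head_in_verts[OF assms, of a]
      wf_digraph.tail_in_verts[OF assms, of a] by (cases b) auto
  next
    case (Cons s' w)
    have "(\<forall>i. Suc i < length (s # s' # w) \<longrightarrow> snd ((s # s' # w) ! Suc i) \<noteq> snd ((s # s' # w) ! i))
      \<longleftrightarrow> snd s' \<noteq> snd s \<and>
        (\<forall>i. Suc i < length (s' # w) \<longrightarrow> snd ((s' # w) ! Suc i) \<noteq> snd ((s' # w) ! i))"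
      by (auto simp: nth_Cons split: nat.split)
    then show ?case
      unfolding bip_walk.simps(2)[of D _ s] underlying_walk.simps(2)[of D _ s] Cons.IH
      by (cases s) auto
  qed
  show ?thesis
  proof (cases w)
    case Nil
    then show ?thesis by (simp add: forward_antidirected_trail_def)
  next
    case (Cons s w')
    show ?thesis
      unfolding forward_antidirected_trail_def antidirected_trail_def Cons * list.sel by blast
  qed
qed

text \<open>Antistrongness speaks only of distinct vertices, and only of first and second copies. A
  third vertex \<open>z\<close> closes the gap: copies with equal marks are connected through the
  opposite copy of \<open>z\<close>, and then \<open>(x, True)\<close> reaches
  \<open>(x, False)\<close> through the copy \<open>(z, True)\<close> of another vertex.\<close>

lemma antistrong_iff_bip_connected:
  assumes "wf_digraph D"
  shows "antistrong D \<longleftrightarrow> 3 \<le> card (verts D) \<and> bip_connected D (arcs D)"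
proof -
  let ?C = "bip_conn D (arcs D)"
  have trail: "(\<exists>w. forward_antidirected_trail D x w y) \<longleftrightarrow> ?C (x, True) (y, False)" for x y
    unfolding bip_walk_iff_underlying[OF assms, symmetric]
    using bip_walk_imp_trail bip_walk_imp_conn bip_conn_imp_walk by blast
  have "bip_connected D (arcs D)"
    if card: "3 \<le> card (verts D)"
      and C: "\<And>x y. x \<in> verts D \<Longrightarrow> y \<in> verts D \<Longrightarrow> x \<noteq> y \<Longrightarrow> ?C (x, True) (y, False)"
  proof -
    have other: "\<exists>z\<in>verts D. z \<noteq> x \<and> z \<noteq> y" for x y
    proof (rule ccontr)
      assume "\<not> ?thesis"
      then have "verts D \<subseteq> {x, y}" by blast
      then have "card (verts D) \<le> card {x, y}" by (intro card_mono) auto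
      also have "\<dots> \<le> 2" by (simp add: card_insert_if)
      finally show False using card by simp
    qed
    have S: "?C q p" if "?C p q" for p q using that edge_ends.conn_sym by metis
    have T: "?C p r" if "?C p q" "?C q r" for p q r using that edge_ends.conn_trans by metis
    have same: "?C (x, b) (y, b)" if xy: "x \<in> verts D" "y \<in> verts D" for x y b
    proof -
      obtain z where z: "z \<in> verts D" "z \<noteq> x" "z \<noteq> y" using other by blast
      show ?thesis
      proof (cases b)
        case True
        have "?C (x, True) (z, False)" "?C (y, True) (z, False)"
          using C[OF xy(1) z(1)] C[OF xy(2) z(1)] z by simp_all
        from T[OF this(1) S[OF this(2)]] show ?thesis using True by simp
      next
        case False
        have "?C (z, True) (x, False)" "?C (z, True) (y, False)"
          using C[OF z(1) xy(1)] C[OF z(1) xy(2)] z by simp_all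
        from T[OF S[OF this(1)] this(2)] show ?thesis using False by simp
      qed
    qed
    have opp: "?C (x, True) (y, False)" if xy: "x \<in> verts D" "y \<in> verts D" for x y
    proof -
      obtain z where z: "z \<in> verts D" "z \<noteq> y" using other by blast
      then have "?C (z, True) (y, False)" using C[OF z(1) xy(2)] by simp
      then show ?thesis by (rule T[OF same[OF xy(1) z(1)]])
    qed
    have all: "?C (x, b) (y, d)" if "x \<in> verts D" "y \<in> verts D" for x y b d
      using same[OF that, of b] opp[OF that] S[OF opp[OF that(2,1)]] by (cases b; cases d) auto
    show ?thesis unfolding bip_connected_def
    proof (intro ballI)
      fix p q assume "p \<in> verts D \<times> (UNIV :: bool set)" "q \<in> verts D \<times> (UNIV :: bool set)"
      then show "?C p q" using all[of "fst p" "fst q" "snd p" "snd q"] by (simp add: mem_Times_iff)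
    qed
  qed
  moreover have "?C (x, True) (y, False)"
    if "bip_connected D (arcs D)" "x \<in> verts D" "y \<in> verts D" for x y
    using that by (simp add: bip_connected_def)
  ultimately show ?thesis unfolding antistrong_def trail by blast
qed

section \<open>Programs with counting loops\<close>

text \<open>
  Programs whose only loops are counting loops: \<open>Count x b P\<close> runs \<open>P\<close> with the counter in cell 0
  of the array \<open>x\<close> ranging over the numbers below the contents of cell 0 of the array \<open>b\<close>.
\<close>

datatype counting =
    Noop
  | Store array expr expr
  | Sequence counting counting (infixr \<open>;;\<close> 60)
  | If cond counting counting
  | Count array array counting

abbreviation Cell :: "array \<Rightarrow> expr" where
  "Cell x \<equiv> Read x (Const 0)"

abbreviation Assign :: "array \<Rightarrow> expr \<Rightarrow> counting" where
  "Assign x e \<equiv> Store x (Const 0) e"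

definition Equal :: "expr \<Rightarrow> expr \<Rightarrow> cond" where
  "Equal e f = Conj (Neg (Less e f)) (Neg (Less f e))"

lemma cond_Equal [simp]: "cond_val (Equal e f) s \<longleftrightarrow> expr_val e s = expr_val f s"
  by (auto simp: Equal_def)

section \<open>Semantics and running time of counting programs\<close>

definition store :: "array \<Rightarrow> nat \<Rightarrow> nat \<Rightarrow> memory \<Rightarrow> memory" where
  "store a i v s = s(a := (s a)(i := v))"

lemma store_apply [simp]: "store a i v s b = (if b = a then (s a)(i := v) else s b)"
  by (simp add: store_def)

lemma exec_store: "exec (Write a e f) s 1 (store a (expr_val e s) (expr_val f s) s)"
  unfolding store_def by (rule exec.Write)

primrec compile :: "counting \<Rightarrow> program" where
  "compile Noop = Skip"
| "compile (Store a e f) = Write a e f"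
| "compile (P ;; Q) = Seq (compile P) (compile Q)"
| "compile (If b P Q) = Branch b (compile P) (compile Q)"
| "compile (Count x b P) =
     Seq (Write x (Const 0) (Const 0))
       (While (Less (Cell x) (Cell b))
         (Seq (compile P) (Write x (Const 0) (Plus (Cell x) (Const 1)))))"

primrec result :: "counting \<Rightarrow> memory \<Rightarrow> memory" where
  "result Noop s = s"
| "result (Store a e f) s = store a (expr_val e s) (expr_val f s) s"
| "result (P ;; Q) s = result Q (result P s)"
| "result (If b P Q) s = (if cond_val b s then result P s else result Q s)"
| "result (Count x b P) s =
     ((\<lambda>s. store x 0 (Suc (s x 0)) (result P s)) ^^ (s b 0)) (store x 0 0 s)"

primrec writes :: "counting \<Rightarrow> array set" where
  "writes Noop = {}"
| "writes (Store a e f) = {a}"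
| "writes (P ;; Q) = writes P \<union> writes Q"
| "writes (If b P Q) = writes P \<union> writes Q"
| "writes (Count x b P) = insert x (writes P)"

primrec bounds :: "counting \<Rightarrow> array set" where
  "bounds Noop = {}"
| "bounds (Store a e f) = {}"
| "bounds (P ;; Q) = bounds P \<union> bounds Q"
| "bounds (If b P Q) = bounds P \<union> bounds Q"
| "bounds (Count x b P) = insert b (bounds P)"

primrec counters_fixed :: "counting \<Rightarrow> bool" where
  "counters_fixed Noop \<longleftrightarrow> True"
| "counters_fixed (Store a e f) \<longleftrightarrow> True"
| "counters_fixed (P ;; Q) \<longleftrightarrow> counters_fixed P \<and> counters_fixed Q"
| "counters_fixed (If b P Q) \<longleftrightarrow> counters_fixed P \<and> counters_fixed Q"
| "counters_fixed (Count x b P) \<longleftrightarrow> x \<notin> writes P \<and> counters_fixed P"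

text \<open>Bounds the running time when all loop bounds are at most \<open>N\<close>. Adding both
  branches of \<open>If\<close> instead of taking the maximum keeps it a polynomial in
  \<open>N\<close>.\<close>

primrec cost :: "nat \<Rightarrow> counting \<Rightarrow> nat" where
  "cost N Noop = 1"
| "cost N (Store a e f) = 1"
| "cost N (P ;; Q) = cost N P + cost N Q"
| "cost N (If b P Q) = 1 + cost N P + cost N Q"
| "cost N (Count x b P) = 2 + N * (cost N P + 2)"

lemma result_frame: "a \<notin> writes P \<Longrightarrow> result P s a = s a"
proof (induction P arbitrary: s)
  case (Count x b P)
  have "((\<lambda>s. store x 0 (Suc (s x 0)) (result P s)) ^^ j) s' a = s' a" for j s'
    using Count by (induction j) auto
  then show ?case using Count.prems by simp
qed auto

text \<open>Invariant rule for counting loops. By \<open>indep\<close> the invariant ignores the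
  counter cell, so setting and incrementing it are harmless; arrays that the body does not write
  keep their contents from loop entry. Where \<open>goal_cases\<close> is used with this rule, cases
  4, 5 and 6 are \<open>indep\<close>, \<open>start\<close> and \<open>step\<close>.\<close>

lemma result_Count:
  assumes "x \<notin> writes P" "b \<notin> writes P" "x \<noteq> b"
    and indep: "\<And>j s v. I j (store x 0 v s) = I j s"
    and start: "I 0 s"
    and step: "\<And>j s'. j < s b 0 \<Longrightarrow> I j s' \<Longrightarrow> s' x 0 = j \<Longrightarrow>
      (\<And>a. a \<notin> writes P \<Longrightarrow> a \<noteq> x \<Longrightarrow> s' a = s a) \<Longrightarrow> I (Suc j) (result P s')"
  shows "I (s b 0) (result (Count x b P) s)"
proof -
  define F where "F = (\<lambda>s. store x 0 (Suc (s x 0)) (result P s))"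
  have "I j ((F ^^ j) (store x 0 0 s)) \<and> (F ^^ j) (store x 0 0 s) x 0 = j \<and>
      (\<forall>a. a \<notin> writes P \<longrightarrow> a \<noteq> x \<longrightarrow> (F ^^ j) (store x 0 0 s) a = s a)" if "j \<le> s b 0" for j
    using that
  proof (induction j)
    case 0
    show ?case unfolding funpow_0 indep using start by simp
  next
    case (Suc j)
    let ?s = "(F ^^ j) (store x 0 0 s)"
    have IH: "I j ?s" "?s x 0 = j" "\<And>a. a \<notin> writes P \<Longrightarrow> a \<noteq> x \<Longrightarrow> ?s a = s a"
      using Suc.IH[OF Suc_leD[OF Suc.prems]] by blast+
    have "I (Suc j) (result P ?s)" using step[of j ?s] IH Suc.prems by simp
    then have "I (Suc j) (F ?s)" using indep by (simp add: F_def)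
    moreover have "F ?s x 0 = Suc j" using IH(2) by (simp add: F_def)
    moreover have "F ?s a = s a" if "a \<notin> writes P" "a \<noteq> x" for a
      using that IH(3)[OF that] result_frame[of a P ?s] by (simp add: F_def)
    ultimately show ?case unfolding funpow.simps o_apply by blast
  qed
  then show ?thesis unfolding result.simps F_def[symmetric] by blast
qed

lemma exec_compile:
  assumes "counters_fixed P" "writes P \<inter> bounds P = {}" "\<And>b. b \<in> bounds P \<Longrightarrow> s b 0 \<le> N"
  shows "\<exists>t \<le> cost N P. exec (compile P) s t (result P s)"
  using assms
proof (induction P arbitrary: s)
  case Noop
  then show ?case using exec.Skip by auto
next
  case (Store a e f)
  show ?case unfolding compile.simps result.simps cost.simps using exec_store by blast
next
  case (Sequence P Q)
  obtain t where t: "t \<le> cost N P" "exec (compile P) s t (result P s)"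
    using Sequence.IH(1)[of s] Sequence.prems by auto
  have "result P s b = s b" if "b \<in> bounds Q" for b
    using that Sequence.prems(2) by (intro result_frame) auto
  then obtain t' where "t' \<le> cost N Q" "exec (compile Q) (result P s) t' (result Q (result P s))"
    using Sequence.IH(2)[of "result P s"] Sequence.prems by auto
  then show ?case using t exec.Seq by (intro exI[of _ "t + t'"]) auto
next
  case (If b P Q)
  show ?case
  proof (cases "cond_val b s")
    case True
    obtain t where "t \<le> cost N P" "exec (compile P) s t (result P s)"
      using If.IH(1)[of s] If.prems by auto
    then show ?thesis using exec.Branch_True[OF True] True by (intro exI[of _ "1 + t"]) auto
  next
    case False
    obtain t where "t \<le> cost N Q" "exec (compile Q) s t (result Q s)"
      using If.IH(2)[of s] If.prems by auto
    then show ?thesis using exec.Branch_False[OF False] False by (intro exI[of _ "1 + t"]) auto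
  qed
next
  case (Count x b P)
  let ?F = "\<lambda>s. store x 0 (Suc (s x 0)) (result P s)"
  let ?W = "While (Less (Cell x) (Cell b))
    (Seq (compile P) (Write x (Const 0) (Plus (Cell x) (Const 1))))"
  have x: "x \<notin> writes P" "x \<noteq> b" "b \<notin> writes P" using Count.prems by auto
  \<comment> \<open>Generalised to \<open>j\<close> rounds still to go. A round pays for the body,
    the test and the increment; the 1 is the final failing test.\<close>
  have loop: "\<exists>t \<le> 1 + j * (cost N P + 2). exec ?W s' t ((?F ^^ j) s')"
    if "s' b 0 = s' x 0 + j" "\<And>c. c \<in> bounds P \<Longrightarrow> s' c 0 \<le> N" for j s'
    using that
  proof (induction j arbitrary: s')
    case 0
    then show ?case using exec.While_False[of "Less (Cell x) (Cell b)" s'] by auto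
  next
    case (Suc j)
    obtain t where t: "t \<le> cost N P" "exec (compile P) s' t (result P s')"
      using Count.IH[of s'] Count.prems(1,2) Suc.prems(2) by auto
    have fr: "result P s' x = s' x" "result P s' b = s' b" using x result_frame by blast+
    have "exec (Write x (Const 0) (Plus (Cell x) (Const 1))) (result P s') 1 (?F s')"
      using exec_store[of x "Const 0" "Plus (Cell x) (Const 1)" "result P s'"] fr by simp
    then have step: "exec (Seq (compile P) (Write x (Const 0) (Plus (Cell x) (Const 1)))) s' (t + 1) (?F s')"
      using exec.Seq t(2) by blast
    have "?F s' b 0 = ?F s' x 0 + j" using Suc.prems(1) fr x by simp
    moreover have "?F s' c 0 \<le> N" if "c \<in> bounds P" for c
    proof -
      have "c \<noteq> x" "c \<notin> writes P" using that Count.prems(2) by auto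
      then show ?thesis using that Suc.prems(2) result_frame by simp
    qed
    ultimately obtain t' where t': "t' \<le> 1 + j * (cost N P + 2)" "exec ?W (?F s') t' ((?F ^^ j) (?F s'))"
      using Suc.IH by blast
    have "exec ?W s' (1 + (t + 1) + t') ((?F ^^ j) (?F s'))"
      using exec.While_True[OF _ step t'(2)] Suc.prems(1) by simp
    then show ?case unfolding funpow_Suc_right o_apply
      using t(1) t'(1) by (intro exI[of _ "1 + (t + 1) + t'"]) simp
  qed
  obtain t where t: "t \<le> 1 + s b 0 * (cost N P + 2)"
      "exec ?W (store x 0 0 s) t ((?F ^^ (s b 0)) (store x 0 0 s))"
  proof -
    have "store x 0 0 s c 0 \<le> N" if "c \<in> bounds P" for c
      using Count.prems(3)[of c] that by simp
    moreover have "store x 0 0 s b 0 = store x 0 0 s x 0 + s b 0" using x by simp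
    ultimately show ?thesis using loop that by blast
  qed
  have "exec (Write x (Const 0) (Const 0)) s 1 (store x 0 0 s)"
    using exec_store[of x "Const 0" "Const 0" s] by simp
  then have "exec (compile (Count x b P)) s (1 + t) (result (Count x b P) s)"
    unfolding compile.simps result.simps by (rule exec.Seq[OF _ t(2)])
  moreover have "s b 0 * (cost N P + 2) \<le> N * (cost N P + 2)"
    using Count.prems(3) by (intro mult_le_mono1) simp
  ultimately show ?case using t(1) by (intro exI[of _ "1 + t"]) simp
qed

declare result.simps(5) [simp del]

lemma exec_compile_subset:
  assumes "counters_fixed P" "bounds P \<subseteq> B" "writes P \<inter> B = {}" "\<And>b. b \<in> B \<Longrightarrow> s b 0 \<le> N"
  shows "\<exists>t \<le> cost N P. exec (compile P) s t (result P s)"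
  using assms by (intro exec_compile) auto

text \<open>There are at most \<open>f s\<close> rounds of cost \<open>T + 1\<close> each, and a
  last test. This serves the main loop, whose number of rounds is not read off a cell.\<close>

lemma exec_While_measure:
  assumes step: "\<And>s. Inv s \<Longrightarrow> cond_val b s \<Longrightarrow>
      \<exists>t s'. exec P s t s' \<and> t \<le> T \<and> Inv s' \<and> f s' < f s"
    and "Inv s"
  shows "\<exists>t s'. exec (While b P) s t s' \<and> t \<le> 1 + f s * (T + 1) \<and> Inv s' \<and> \<not> cond_val b s'"
  using assms(2)
proof (induction "f s" arbitrary: s rule: less_induct)
  case less
  show ?case
  proof (cases "cond_val b s")
    case False
    then show ?thesis using exec.While_False less.prems by fastforce
  next
    case True
    obtain t s1 where s1: "exec P s t s1" "t \<le> T" "Inv s1" "f s1 < f s"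
      using step less.prems True by blast
    obtain t' s2 where s2: "exec (While b P) s1 t' s2" "t' \<le> 1 + f s1 * (T + 1)" "Inv s2"
        "\<not> cond_val b s2"
      using less.hyps s1 by blast
    have "Suc (f s1) * (T + 1) \<le> f s * (T + 1)" using s1(4) by (intro mult_le_mono1) simp
    then have "1 + t + t' \<le> 1 + f s * (T + 1)" using s1(2) s2(2) by simp
    then show ?thesis using exec.While_True[OF True s1(1) s2(1)] s2 by blast
  qed
qed

section \<open>Component labels\<close>

text \<open>
  The programs below keep a component label \<open>T v\<close>, \<open>H v\<close> for the copies of \<open>v\<close> marked \<open>True\<close>,
  \<open>False\<close> in the bipartite representation, and the colour \<open>col a\<close> and level \<open>lev a\<close> of each arc \<open>a\<close>.
  As \<open>c\<close> counts from 0, the class under consideration is \<open>c + 1\<close>.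
\<close>

definition init_labels :: counting where
  "init_labels = Count ''v'' ''n''
     (Assign ''z'' (Read ''vs'' (Cell ''v'')) ;;
      Store ''T'' (Cell ''z'') (Plus (Cell ''z'') (Cell ''z'')) ;;
      Store ''H'' (Cell ''z'') (Plus (Plus (Cell ''z'') (Cell ''z'')) (Const 1)))"

text \<open>The two labels are saved in \<open>''x''\<close> and \<open>''y''\<close> first, because
  the loop overwrites the entries they are read from.\<close>

definition merge_labels :: counting where
  "merge_labels =
     Assign ''x'' (Read ''T'' (Read ''tl'' (Cell ''b''))) ;;
     Assign ''y'' (Read ''H'' (Read ''hd'' (Cell ''b''))) ;;
     Count ''v'' ''n''
       (Assign ''z'' (Read ''vs'' (Cell ''v'')) ;;
        If (Equal (Read ''T'' (Cell ''z'')) (Cell ''x'')) (Store ''T'' (Cell ''z'') (Cell ''y'')) Noop ;;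
        If (Equal (Read ''H'' (Cell ''z'')) (Cell ''x'')) (Store ''H'' (Cell ''z'') (Cell ''y'')) Noop)"

definition merge_arcs :: "cond \<Rightarrow> counting" where
  "merge_arcs c = Count ''j'' ''m''
     (Assign ''b'' (Read ''as'' (Cell ''j'')) ;; If c merge_labels Noop)"

abbreviation joined :: cond where
  "joined \<equiv> Equal (Read ''T'' (Read ''tl'' (Cell ''a''))) (Read ''H'' (Read ''hd'' (Cell ''a'')))"

abbreviation in_class :: cond where
  "in_class \<equiv> Equal (Read ''col'' (Cell ''b'')) (Plus (Cell ''c'') (Const 1))"

abbreviation lower :: cond where
  "lower \<equiv> Less (Read ''lev'' (Cell ''b'')) (Read ''lev'' (Cell ''a''))"

text \<open>The flag \<open>''g''\<close> stops the merging at the first arc that joins the ends of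
  the given one, so that \<open>''f''\<close> keeps it. If the flag stays 0, the given arc can be
  inserted outright.\<close>

definition find_arc :: counting where
  "find_arc = Assign ''g'' (Const 0) ;;
     Count ''j'' ''m''
       (Assign ''b'' (Read ''as'' (Cell ''j'')) ;;
        If (Conj in_class (Conj lower (Equal (Cell ''g'') (Const 0))))
          (merge_labels ;; If joined (Assign ''g'' (Const 1) ;; Assign ''f'' (Cell ''b'')) Noop)
          Noop)"

text \<open>
  Only if the arcs of the class whose level is at least that of \<open>a\<close> do not span \<open>a\<close>, the others are
  added one by one. The first one that joins the ends of \<open>a\<close> can be exchanged for \<open>a\<close>.
\<close>

definition try_class :: counting where
  "try_class = init_labels ;; merge_arcs (Conj in_class (Neg lower)) ;;
     If joined Noop
       (find_arc ;;
        Store ''col'' (Cell ''a'') (Plus (Cell ''c'') (Const 1)) ;;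
        If (Equal (Cell ''g'') (Const 1)) (Store ''col'' (Cell ''f'') (Const 0)) Noop ;;
        Assign ''done'' (Const 1))"

definition process_arc :: counting where
  "process_arc = Assign ''done'' (Const 0) ;;
     Count ''c'' ''k'' (If (Equal (Cell ''done'') (Const 0)) try_class Noop) ;;
     If (Equal (Cell ''done'') (Const 0))
       (Store ''lev'' (Cell ''a'') (Plus (Read ''lev'' (Cell ''a'')) (Const 1))) Noop"

text \<open>A step may uncover an arc at an earlier position or leave the current one still
  unfinished, so the scan restarts at 0 after each step.\<close>

definition scan_arc :: counting where
  "scan_arc = Assign ''a'' (Read ''as'' (Cell ''e'')) ;;
     If (Conj (Equal (Read ''col'' (Cell ''a'')) (Const 0)) (Less (Read ''lev'' (Cell ''a'')) (Cell ''m'')))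
       (process_arc ;; Assign ''e'' (Const 0))
       (Assign ''e'' (Plus (Cell ''e'') (Const 1)))"

lemmas writes_simps = init_labels_def merge_labels_def merge_arcs_def find_arc_def try_class_def
  process_arc_def scan_arc_def

definition static_arrays :: "array set" where
  "static_arrays = {''k'', ''n'', ''m'', ''vs'', ''as'', ''tl'', ''hd''}"

section \<open>Correctness of the component labels\<close>

locale coded_digraph =
  fixes D :: "(nat, nat) pre_digraph" and k :: nat and vs as :: "nat list"
  assumes wf_D: "wf_digraph D"
    and distinct_vs: "distinct vs" and set_vs: "set vs = verts D"
    and distinct_as: "distinct as" and set_as: "set as = arcs D"
begin

lemma ends_in_verts [simp]: "a \<in> arcs D \<Longrightarrow> tail D a \<in> verts D" "a \<in> arcs D \<Longrightarrow> head D a \<in> verts D"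
  using wf_D by (simp_all add: wf_digraph_def)

sublocale bip: edge_ends "bip_source D" "bip_target D" .

sublocale part: matroid_partition bip.span "arcs D"
  by unfold_locales (simp flip: set_as)

lemma length_as: "length as = card (arcs D)"
  using distinct_card[OF distinct_as] set_as by simp

definition static :: "memory \<Rightarrow> bool" where
  "static s \<longleftrightarrow> s ''k'' 0 = k \<and> s ''n'' 0 = length vs \<and> s ''m'' 0 = length as \<and>
     (\<forall>i<length vs. s ''vs'' i = vs ! i) \<and> (\<forall>j<length as. s ''as'' j = as ! j) \<and>
     (\<forall>a\<in>arcs D. s ''tl'' a = tail D a \<and> s ''hd'' a = head D a)"

lemma static_cong: "static s \<Longrightarrow> (\<And>a. a \<in> static_arrays \<Longrightarrow> s' a = s a) \<Longrightarrow> static s'"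
  by (simp add: static_def static_arrays_def)

lemma static_result: "static s \<Longrightarrow> writes P \<inter> static_arrays = {} \<Longrightarrow> static (result P s)"
  by (rule static_cong) (use result_frame in blast)+

definition label :: "memory \<Rightarrow> nat \<times> bool \<Rightarrow> nat" where
  "label s p = (if snd p then s ''T'' (fst p) else s ''H'' (fst p))"

definition labels :: "memory \<Rightarrow> nat set \<Rightarrow> bool" where
  "labels s X \<longleftrightarrow> (\<forall>p \<in> verts D \<times> UNIV. \<forall>q \<in> verts D \<times> UNIV.
     label s p = label s q \<longleftrightarrow> bip.conn X p q)"

lemma labels_cong:
  assumes "labels s X" "s' ''T'' = s ''T''" "s' ''H'' = s ''H''"
  shows "labels s' X"
proof -
  have "label s' = label s" using assms(2,3) by (simp add: label_def fun_eq_iff)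
  then show ?thesis using assms(1) by (simp only: labels_def)
qed

lemma labels_arc:
  assumes "labels s X" "a \<in> arcs D"
  shows "s ''T'' (tail D a) = s ''H'' (head D a) \<longleftrightarrow> a \<in> bip.span X"
proof -
  have "bip_source D a \<in> verts D \<times> UNIV" "bip_target D a \<in> verts D \<times> UNIV"
    using assms(2) by simp_all
  then have "label s (bip_source D a) = label s (bip_target D a) \<longleftrightarrow>
      bip.conn X (bip_source D a) (bip_target D a)"
    by (rule assms(1)[unfolded labels_def, rule_format])
  then show ?thesis by (simp add: label_def bip.span_def)
qed

text \<open>Loops over \<open>''v''\<close> give facts about positions in \<open>vs\<close>; this
  carries them over to all vertex copies.\<close>

lemma label_pointwise:
  assumes "\<And>i. i < length vs \<Longrightarrow> f (s ''T'' (vs ! i)) (vs ! i) True \<and> f (s ''H'' (vs ! i)) (vs ! i) False"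
    and "p \<in> verts D \<times> UNIV"
  shows "f (label s p) (fst p) (snd p)"
proof -
  have "fst p \<in> set vs" unfolding set_vs using assms(2) by (simp add: mem_Times_iff)
  then obtain i where "i < length vs" "vs ! i = fst p" by (metis in_set_conv_nth)
  then show ?thesis using assms(1)[of i] by (cases "snd p") (auto simp: label_def)
qed

text \<open>The labels \<open>2 * v\<close> and \<open>2 * v + 1\<close> are pairwise distinct, and
  without edges every copy is a component of its own.\<close>

lemma labels_init:
  assumes "static s"
  shows "labels (result init_labels s) {}"
proof -
  let ?I = "\<lambda>j s. \<forall>i<j. s ''T'' (vs ! i) = 2 * vs ! i \<and> s ''H'' (vs ! i) = Suc (2 * vs ! i)"
  have "?I (s ''n'' 0) (result init_labels s)"
    unfolding init_labels_def
  proof (rule result_Count[where I = ?I], goal_cases)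
    case (6 j s')
    have *: "j < length vs" "s' ''vs'' j = vs ! j" using 6 assms by (simp_all add: static_def)
    show ?case using 6 * distinct_vs by (auto simp: less_Suc_eq)
  qed simp_all
  then have "label (result init_labels s) p = 2 * fst p + (if snd p then 0 else 1)"
    if "p \<in> verts D \<times> UNIV" for p
    using that assms
    by (intro label_pointwise[where f = "\<lambda>l v b. l = 2 * v + (if b then 0 else 1)"])
      (auto simp: static_def)
  moreover have "2 * fst p + (if snd p then 0 else 1) = 2 * fst q + (if snd q then 0 else 1) \<longleftrightarrow> p = q"
    for p q :: "nat \<times> bool"
    by (cases p; cases q) (auto, presburger+)
  ultimately show ?thesis
    by (simp add: labels_def bip.conn_empty)
qed

text \<open>Renaming one label to another merges two components, which by \<open>conn_insert\<close>
  is the effect of one further edge.\<close>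

lemma labels_merge:
  assumes "static s" "labels s X" "s ''b'' 0 \<in> arcs D"
  shows "labels (result merge_labels s) (insert (s ''b'' 0) X)"
proof -
  define b where "b = s ''b'' 0"
  define x where "x = s ''T'' (tail D b)"
  define y where "y = s ''H'' (head D b)"
  define s0 where "s0 = store ''y'' 0 y (store ''x'' 0 x s)"
  define r where "r = (\<lambda>l. if l = x then y else l)"
  define body where "body = Assign ''z'' (Read ''vs'' (Cell ''v'')) ;;
        If (Equal (Read ''T'' (Cell ''z'')) (Cell ''x'')) (Store ''T'' (Cell ''z'') (Cell ''y'')) Noop ;;
        If (Equal (Read ''H'' (Cell ''z'')) (Cell ''x'')) (Store ''H'' (Cell ''z'') (Cell ''y'')) Noop"
  have res: "result merge_labels s = result (Count ''v'' ''n'' body) s0"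
    using assms(1,3) by (simp add: merge_labels_def body_def s0_def x_def y_def b_def static_def)
  \<comment> \<open>Entries before position \<open>j\<close> are renamed, the others still original.
    As \<open>vs\<close> is distinct, round \<open>j\<close> touches the entries of position
    \<open>j\<close> alone.\<close>
  let ?I = "\<lambda>j s'. \<forall>i<length vs.
    s' ''T'' (vs ! i) = (if i < j then r (s ''T'' (vs ! i)) else s ''T'' (vs ! i)) \<and>
    s' ''H'' (vs ! i) = (if i < j then r (s ''H'' (vs ! i)) else s ''H'' (vs ! i))"
  have "?I (s0 ''n'' 0) (result (Count ''v'' ''n'' body) s0)"
  proof (rule result_Count[where I = ?I], goal_cases)
    case (6 j s')
    have "s' ''vs'' = s ''vs''" "s' ''x'' = s0 ''x''" "s' ''y'' = s0 ''y''"
      using 6(4)[of "''vs''"] 6(4)[of "''x''"] 6(4)[of "''y''"] by (simp_all add: body_def s0_def)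
    then have *: "j < length vs" "s' ''vs'' j = vs ! j" "s' ''x'' 0 = x" "s' ''y'' 0 = y"
      using 6(1) assms(1) by (simp_all add: static_def s0_def)
    show ?case
    proof (intro allI impI)
      fix i assume i: "i < length vs"
      have eq: "vs ! i = vs ! j \<longleftrightarrow> i = j" using distinct_vs * i by (simp add: nth_eq_iff_index_eq)
      show "result body s' ''T'' (vs ! i) = (if i < Suc j then r (s ''T'' (vs ! i)) else s ''T'' (vs ! i)) \<and>
        result body s' ''H'' (vs ! i) = (if i < Suc j then r (s ''H'' (vs ! i)) else s ''H'' (vs ! i))"
        using * 6(2)[rule_format, OF i] 6(2)[rule_format, OF *(1)] 6(3) eq
        by (auto simp: body_def r_def less_Suc_eq)
    qed
  qed (simp_all add: body_def s0_def)
  then have "label (result merge_labels s) p = r (label s p)" if "p \<in> verts D \<times> UNIV" for p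
    using label_pointwise[where f = "\<lambda>l v b. l = r (label s (v, b))", OF _ that] assms(1)
    unfolding res by (simp add: label_def static_def s0_def)
  moreover have "r (label s p) = r (label s q) \<longleftrightarrow> bip.conn (insert b X) p q"
    if "p \<in> verts D \<times> UNIV" "q \<in> verts D \<times> UNIV" for p q
  proof -
    have L: "label s p' = label s q' \<longleftrightarrow> bip.conn X p' q'"
      if "p' \<in> verts D \<times> UNIV" "q' \<in> verts D \<times> UNIV" for p' q'
      using that assms(2) unfolding labels_def by blast
    have ends: "bip_source D b \<in> verts D \<times> UNIV" "bip_target D b \<in> verts D \<times> UNIV"
      using assms(3) by (simp_all add: b_def)
    have "x = label s (bip_source D b)" "y = label s (bip_target D b)"
      by (simp_all add: x_def y_def label_def)
    then have "label s p = x \<longleftrightarrow> bip.conn X p (bip_source D b)"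
        "label s q = x \<longleftrightarrow> bip.conn X (bip_source D b) q"
        "label s p = y \<longleftrightarrow> bip.conn X p (bip_target D b)"
        "label s q = y \<longleftrightarrow> bip.conn X (bip_target D b) q"
      using L[OF that(1) ends(1)] L[OF ends(1) that(2)] L[OF that(1) ends(2)] L[OF ends(2) that(2)]
      by (simp_all, metis+)
    then show ?thesis
      unfolding bip.conn_insert L[OF that, symmetric] by (auto simp: r_def)
  qed
  ultimately show ?thesis unfolding labels_def b_def by simp
qed

lemma static_in_loop:
  assumes "static s" "\<And>a. a \<notin> W \<Longrightarrow> s' a = s a" "W \<inter> static_arrays = {}"
  shows "static s'"
  by (rule static_cong[OF assms(1)]) (use assms(2,3) in blast)

text \<open>The test \<open>c\<close> may read any array that merging leaves alone; it has to agree
  with \<open>Q\<close> only in states that differ from \<open>s\<close> in the arrays the loop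
  writes.\<close>

lemma labels_merge_arcs:
  assumes s: "static s" "labels s {}"
    and c: "\<And>s'. (\<And>a. a \<notin> insert ''b'' (insert ''j'' (writes merge_labels)) \<Longrightarrow> s' a = s a) \<Longrightarrow>
      s' ''b'' 0 \<in> arcs D \<Longrightarrow> cond_val c s' \<longleftrightarrow> Q (s' ''b'' 0)"
  shows "labels (result (merge_arcs c) s) {a \<in> arcs D. Q a}"
proof -
  define P where "P = Assign ''b'' (Read ''as'' (Cell ''j'')) ;; If c merge_labels Noop"
  have W: "writes P = insert ''b'' (writes merge_labels)" by (simp add: P_def)
  let ?I = "\<lambda>j s'. labels s' {a \<in> set (take j as). Q a}"
  have "?I (s ''m'' 0) (result (Count ''j'' ''m'' P) s)"
  proof (rule result_Count[where I = ?I], goal_cases)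
    case (6 j s')
    have st: "static s'"
      by (rule static_in_loop[OF s(1), of "insert ''j'' (writes P)"])
        (use 6(4) in \<open>auto simp: P_def merge_labels_def static_arrays_def\<close>)
    have j: "j < length as" "s' ''as'' j = as ! j" using 6(1) s(1) st by (simp_all add: static_def)
    define s1 where "s1 = store ''b'' 0 (as ! j) s'"
    have res: "result P s' = (if cond_val c s1 then result merge_labels s1 else s1)"
      using 6(3) j by (simp add: P_def s1_def)
    have b: "s1 ''b'' 0 = as ! j" by (simp add: s1_def)
    have arc: "as ! j \<in> arcs D" using nth_mem[OF j(1)] unfolding set_as .
    have "cond_val c s1 \<longleftrightarrow> Q (as ! j)"
    proof (subst b[symmetric], rule c)
      show "s1 a = s a" if "a \<notin> insert ''b'' (insert ''j'' (writes merge_labels))" for a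
        using that 6(4)[of a] unfolding W by (simp add: s1_def)
      show "s1 ''b'' 0 \<in> arcs D" using b arc by simp
    qed
    moreover have st1: "static s1" by (rule static_cong[OF st]) (auto simp: s1_def static_arrays_def)
    moreover have l1: "labels s1 {a \<in> set (take j as). Q a}"
      by (rule labels_cong[OF 6(2)]) (simp_all add: s1_def)
    moreover have "set (take (Suc j) as) = insert (as ! j) (set (take j as))"
      using j by (simp add: take_Suc_conv_app_nth)
    then have "{a \<in> set (take (Suc j) as). Q a} =
        (if Q (as ! j) then insert (as ! j) else id) {a \<in> set (take j as). Q a}"
      by auto
    ultimately show ?case
      using labels_merge[OF st1 l1] b arc unfolding res
      by (cases "Q (as ! j)") (simp_all only: if_True if_False id_apply)
  next
    case (4 j s v)
    show ?case by (simp add: labels_def label_def)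
  qed (use s in \<open>simp_all add: P_def merge_labels_def\<close>)
  moreover have "s ''m'' 0 = length as" using s(1) by (simp add: static_def)
  ultimately show ?thesis unfolding merge_arcs_def P_def
    by (simp only: take_all[OF order_refl] set_as)
qed

end

section \<open>One step of the push-relabel algorithm\<close>

context coded_digraph
begin

lemma cond_joined:
  assumes "static s" "labels s X" "s ''a'' 0 \<in> arcs D"
  shows "cond_val joined s \<longleftrightarrow> s ''a'' 0 \<in> bip.span X"
  unfolding cond_Equal using labels_arc[OF assms(2,3)] assms(1,3) by (simp add: static_def)

text \<open>\<open>Z j\<close> collects the arcs merged in the first \<open>j\<close> rounds while
  \<open>''g''\<close> is 0. If an arc is found, \<open>Y\<close> is \<open>Z j\<close> just before
  its merging, which is the certificate that \<open>swap_step\<close> asks for.\<close>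

lemma find_arc:
  assumes s: "static s" "labels s X" and a: "s ''a'' 0 = a" "a \<in> arcs D" "a \<notin> bip.span X"
  defines "Q \<equiv> \<lambda>b. s ''col'' b = Suc (s ''c'' 0) \<and> s ''lev'' b < s ''lev'' a"
  defines "s' \<equiv> result find_arc s"
  shows "(s' ''g'' 0 = 0 \<and> a \<notin> bip.span (X \<union> {b \<in> arcs D. Q b})) \<or>
    (s' ''g'' 0 = 1 \<and> s' ''f'' 0 \<in> arcs D \<and> Q (s' ''f'' 0) \<and>
      (\<exists>Y \<subseteq> X \<union> {b \<in> arcs D. Q b}. a \<notin> bip.span Y \<and> a \<in> bip.span (insert (s' ''f'' 0) Y)))"
proof -
  define P where "P = Assign ''b'' (Read ''as'' (Cell ''j'')) ;;
        If (Conj in_class (Conj lower (Equal (Cell ''g'') (Const 0))))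
          (merge_labels ;; If joined (Assign ''g'' (Const 1) ;; Assign ''f'' (Cell ''b'')) Noop)
          Noop"
  define s0 where "s0 = store ''g'' 0 0 s"
  have W: "writes P = {''b'', ''x'', ''y'', ''v'', ''z'', ''T'', ''H'', ''g'', ''f''}"
    by (auto simp: P_def merge_labels_def)
  have s0: "static s0" by (rule static_cong[OF s(1)]) (auto simp: s0_def static_arrays_def)
  define Z where "Z = (\<lambda>j. X \<union> {b \<in> set (take j as). Q b})"
  define I where "I = (\<lambda>j t. (t ''g'' 0 = 0 \<and> labels t (Z j) \<and> a \<notin> bip.span (Z j)) \<or>
    (t ''g'' 0 = 1 \<and> t ''f'' 0 \<in> arcs D \<and> Q (t ''f'' 0) \<and>
      (\<exists>Y \<subseteq> X \<union> {b \<in> arcs D. Q b}. a \<notin> bip.span Y \<and> a \<in> bip.span (insert (t ''f'' 0) Y))))"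
  have "I (s0 ''m'' 0) (result (Count ''j'' ''m'' P) s0)"
  proof (rule result_Count[where I = I], goal_cases)
    case (4 j t v)
    show ?case by (simp add: I_def labels_def label_def)
  next
    case 5
    have "labels s0 X" by (rule labels_cong[OF s(2)]) (simp_all add: s0_def)
    moreover have "s0 ''g'' 0 = 0" by (simp add: s0_def)
    ultimately show ?case using a by (simp add: I_def Z_def)
  next
    case (6 j t)
    have fr: "t x = s x" if "x \<notin> {''b'', ''x'', ''y'', ''v'', ''z'', ''T'', ''H'', ''g'', ''f'', ''j''}" for x
      using that 6(4)[of x] unfolding W by (simp add: s0_def)
    have st: "static t"
      by (rule static_in_loop[OF s(1)], erule fr) (simp add: static_arrays_def)
    have len: "length as = s0 ''m'' 0" using s0 by (simp add: static_def)
    have j: "j < length as" "t ''as'' j = as ! j" using 6(1) st unfolding len[symmetric] by (simp_all add: static_def)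
    define b where "b = as ! j"
    have arc: "b \<in> arcs D" using nth_mem[OF j(1)] unfolding set_as b_def .
    define t1 where "t1 = store ''b'' 0 b t"
    have st1: "static t1" by (rule static_cong[OF st]) (auto simp: t1_def static_arrays_def)
    have cond: "cond_val (Conj in_class (Conj lower (Equal (Cell ''g'') (Const 0)))) t1 \<longleftrightarrow>
        Q b \<and> t ''g'' 0 = 0"
      unfolding cond_val.simps(3) cond_Equal unfolding Q_def
      using a(1) fr[of "''col''"] fr[of "''lev''"] fr[of "''c''"] fr[of "''a''"]
      by (simp add: t1_def)
    have "result (Assign ''b'' (Read ''as'' (Cell ''j''))) t = t1"
      using j by (simp add: t1_def b_def 6(3))
    then have P: "result P t = (if Q b \<and> t ''g'' 0 = 0
        then result (merge_labels ;; If joined (Assign ''g'' (Const 1) ;; Assign ''f'' (Cell ''b'')) Noop) t1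
        else t1)"
      unfolding P_def by (simp only: result.simps(1,3,4) cond)
    have b: "t1 ''b'' 0 = b" by (simp add: t1_def)
    have ZS: "Z (Suc j) = (if Q b then insert b (Z j) else Z j)"
      using j(1) by (auto simp: Z_def b_def take_Suc_conv_app_nth)
    show ?case
    proof (cases "Q b \<and> t ''g'' 0 = 0")
      case False
      then have "result P t = t1" using P by (simp only: if_False)
      moreover have t1: "t1 ''g'' = t ''g''" "t1 ''f'' = t ''f''" by (simp_all add: t1_def)
      have "I (Suc j) t1"
      proof (cases "t ''g'' 0 = 0")
        case True
        then have "labels t (Z j)" "a \<notin> bip.span (Z j)" using 6(2) by (simp_all add: I_def)
        moreover from this(1) have "labels t1 (Z j)" by (rule labels_cong) (simp_all add: t1_def)
        moreover have "Z (Suc j) = Z j" using False True ZS by presburger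
        ultimately show ?thesis unfolding I_def using True t1 by presburger
      next
        case False
        then show ?thesis using 6(2) unfolding I_def t1 by (simp only: simp_thms)
      qed
      ultimately show ?thesis by presburger
    next
      case True
      define t2 where "t2 = result merge_labels t1"
      have res: "result P t = (if cond_val joined t2 then store ''f'' 0 b (store ''g'' 0 1 t2) else t2)"
      proof -
        have "result P t = result (If joined (Assign ''g'' (Const 1) ;; Assign ''f'' (Cell ''b'')) Noop) t2"
          using P True by (simp only: if_True t2_def result.simps(3) simp_thms)
        moreover have "t2 ''b'' = t1 ''b''"
          unfolding t2_def by (rule result_frame) (simp add: merge_labels_def)
        ultimately show ?thesis using b by simp
      qed
      have It: "t ''g'' 0 = 0" "labels t (Z j)" "a \<notin> bip.span (Z j)"
        using 6(2) True by (auto simp: I_def)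
      have "labels t1 (Z j)" by (rule labels_cong[OF It(2)]) (simp_all add: t1_def)
      then have l2: "labels t2 (insert b (Z j))"
        using labels_merge[OF st1, of "Z j"] b arc unfolding t2_def by simp
      have st2: "static t2" unfolding t2_def
        by (rule static_result[OF st1]) (simp add: merge_labels_def static_arrays_def)
      have fr2: "t2 ''a'' = t ''a''" "t2 ''g'' = t ''g''"
        using result_frame[of "''a''" merge_labels t1] result_frame[of "''g''" merge_labels t1]
        unfolding t2_def by (simp_all add: merge_labels_def t1_def)
      then have a2: "t2 ''a'' 0 = a" using fr[of "''a''"] a by simp
      have joined: "cond_val joined t2 \<longleftrightarrow> a \<in> bip.span (insert b (Z j))"
        using cond_joined[OF st2 l2] a2 a(2) by simp
      show ?thesis
      proof (cases "cond_val joined t2")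
        case False
        then have "a \<notin> bip.span (Z (Suc j))" "labels t2 (Z (Suc j))"
          using joined True l2 ZS by simp_all
        then show ?thesis using False res fr2 It(1) by (simp add: I_def)
      next
        case ok: True
        have "set (take j as) \<subseteq> arcs D" using set_take_subset[of j as] unfolding set_as .
        then have "Z j \<subseteq> X \<union> {b \<in> arcs D. Q b}" by (auto simp: Z_def)
        then have "\<exists>Y \<subseteq> X \<union> {b \<in> arcs D. Q b}. a \<notin> bip.span Y \<and> a \<in> bip.span (insert b Y)"
          using It(3) ok joined by blast
        then show ?thesis using ok res arc True by (simp add: I_def)
      qed
    qed
  qed (simp_all add: W)
  moreover have "s0 ''m'' 0 = length as" using s0 by (simp add: static_def)
  then have "Z (s0 ''m'' 0) = X \<union> {b \<in> arcs D. Q b}"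
    unfolding Z_def by (simp only: take_all[OF order_refl] set_as)
  moreover have "s' = result (Count ''j'' ''m'' P) s0"
    by (simp add: s'_def find_arc_def P_def s0_def)
  ultimately show ?thesis unfolding I_def by auto
qed

text \<open>In the first alternative the class already spans \<open>a\<close> by its arcs of level
  at least that of \<open>a\<close>. Otherwise the outcome of \<open>find_arc\<close> supplies the
  hypotheses of \<open>insert_step\<close> or \<open>swap_step\<close>.\<close>

lemma try_class:
  assumes s: "static s" and a: "s ''a'' 0 = a" "a \<in> arcs D" "s ''col'' a = 0"
    and c: "s ''c'' 0 = c" "c < k" and v: "part.valid k (s ''col'') (s ''lev'')"
  defines "s' \<equiv> result try_class s"
  shows "(a \<in> bip.span {f \<in> part.colour_class (s ''col'') (Suc c). s ''lev'' a \<le> s ''lev'' f} \<and>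
      s' ''col'' = s ''col'' \<and> s' ''done'' = s ''done'') \<or>
    (part.valid k (s' ''col'') (s ''lev'') \<and>
      part.potential (s' ''col'') (s ''lev'') < part.potential (s ''col'') (s ''lev'') \<and>
      s' ''done'' 0 = 1)"
proof -
  define col lev where "col = s ''col''" and "lev = s ''lev''"
  define s1 where "s1 = result init_labels s"
  define s2 where "s2 = result (merge_arcs (Conj in_class (Neg lower))) s1"
  define X where "X = {f \<in> part.colour_class col (Suc c). lev a \<le> lev f}"
  have fr1: "s1 x = s x" if "x \<notin> {''v'', ''z'', ''T'', ''H''}" for x
    unfolding s1_def by (rule result_frame) (use that in \<open>simp add: init_labels_def\<close>)
  have fr2: "s2 x = s x" if "x \<notin> {''b'', ''x'', ''y'', ''v'', ''z'', ''T'', ''H'', ''j''}" for x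
    using fr1[of x] result_frame[of x "merge_arcs (Conj in_class (Neg lower))" s1] that
    unfolding s2_def by (simp add: merge_arcs_def merge_labels_def)
  have st1: "static s1" by (rule static_in_loop[OF s], erule fr1) (simp add: static_arrays_def)
  have st2: "static s2" by (rule static_in_loop[OF s], erule fr2) (simp add: static_arrays_def)
  have l1: "labels s1 {}" unfolding s1_def by (rule labels_init[OF s])
  have "labels s2 {b \<in> arcs D. col b = Suc c \<and> lev a \<le> lev b}"
    unfolding s2_def
  proof (rule labels_merge_arcs[OF st1 l1], goal_cases)
    case (1 t)
    have "t x = s x" if "x \<in> {''col'', ''lev'', ''a'', ''c''}" for x
      using that 1(1)[of x] fr1[of x] by (auto simp: merge_labels_def)
    then have "t ''col'' = col" "t ''lev'' = lev" "t ''a'' 0 = a" "t ''c'' 0 = c"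
      using a c by (simp_all add: col_def lev_def)
    then show ?case unfolding cond_val.simps(3) cond_Equal by auto
  qed
  then have l2: "labels s2 X" by (simp add: X_def part.colour_class_def conj_assoc)
  have a2: "s2 ''a'' 0 = a" using fr2[of "''a''"] a by simp
  have cond: "cond_val joined s2 \<longleftrightarrow> a \<in> bip.span X"
    using cond_joined[OF st2 l2] a2 a(2) by simp
  show ?thesis
  proof (cases "a \<in> bip.span X")
    case True
    then have "s' = s2"
      unfolding s'_def try_class_def result.simps s1_def[symmetric] s2_def[symmetric] using cond by simp
    then show ?thesis using True fr2[of "''col''"] fr2[of "''done''"]
      by (simp add: X_def col_def lev_def)
  next
    case False
    define s3 where "s3 = result find_arc s2"
    define f where "f = s3 ''f'' 0"
    have fr3: "s3 x = s x" if "x \<in> {''a'', ''c'', ''col'', ''lev''}" for x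
      using fr2[of x] result_frame[of x find_arc s2] that unfolding s3_def
      by (auto simp: find_arc_def merge_labels_def)
    have s': "s' ''col'' = (if s3 ''g'' 0 = 1 then col(a := Suc c, f := 0) else col(a := Suc c))"
        "s' ''done'' 0 = 1"
    proof -
      have "s' = result (Store ''col'' (Cell ''a'') (Plus (Cell ''c'') (Const 1)) ;;
        If (Equal (Cell ''g'') (Const 1)) (Store ''col'' (Cell ''f'') (Const 0)) Noop ;;
        Assign ''done'' (Const 1)) s3"
        unfolding s'_def try_class_def result.simps s1_def[symmetric] s2_def[symmetric] s3_def
        by (simp only: cond False if_False)
      then show "s' ''col'' = (if s3 ''g'' 0 = 1 then col(a := Suc c, f := 0) else col(a := Suc c))"
          "s' ''done'' 0 = 1"
        using fr3[of "''a''"] fr3[of "''c''"] fr3[of "''col''"] a(1) c(1)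
        unfolding result.simps cond_Equal by (simp_all add: col_def f_def)
    qed
    \<comment> \<open>The arcs merged beforehand and those tried by \<open>find_arc\<close> make up
      the whole class.\<close>
    have X: "X \<union> {b \<in> arcs D. col b = Suc c \<and> lev b < lev a} = part.colour_class col (Suc c)"
      by (auto simp: X_def part.colour_class_def)
    have found: "(s3 ''g'' 0 = 0 \<and> a \<notin> bip.span (part.colour_class col (Suc c))) \<or>
      (s3 ''g'' 0 = 1 \<and> f \<in> arcs D \<and> (col f = Suc c \<and> lev f < lev a) \<and>
        (\<exists>Y \<subseteq> part.colour_class col (Suc c). a \<notin> bip.span Y \<and> a \<in> bip.span (insert f Y)))"
      using find_arc[OF st2 l2 a2 a(2) False] fr2[of "''col''"] fr2[of "''lev''"] fr2[of "''c''"] c(1)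
      unfolding s3_def[symmetric] f_def[symmetric] by (simp add: X flip: col_def lev_def)
    have v': "part.valid k col lev" using v by (simp add: col_def lev_def)
    have a': "col a = 0" using a by (simp add: col_def)
    have i: "Suc c \<in> {1..k}" using c by simp
    from found have "part.valid k (s' ''col'') lev \<and> part.potential (s' ''col'') lev < part.potential col lev"
    proof (elim disjE conjE exE)
      assume "s3 ''g'' 0 = 0" "a \<notin> bip.span (part.colour_class col (Suc c))"
      then show ?thesis using part.insert_step[OF v' a(2) a' i] s' by simp
    next
      fix Y assume Y: "s3 ''g'' 0 = 1" "f \<in> arcs D" "col f = Suc c" "lev f < lev a"
        "Y \<subseteq> part.colour_class col (Suc c)" "a \<notin> bip.span Y" "a \<in> bip.span (insert f Y)"
      have "f \<notin> Y" using Y(6,7) by (metis insert_absorb)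
      moreover have "f \<in> part.colour_class col (Suc c)" using Y by (simp add: part.colour_class_def)
      ultimately show ?thesis using part.swap_step[OF v' a(2) a' i _ _ Y(4-7)] s' Y(1) by simp
    qed
    then show ?thesis using s' by (simp add: col_def lev_def)
  qed
qed

text \<open>If \<open>''done''\<close> is still 0 after all classes, each of them spans
  \<open>a\<close> by arcs of level at least \<open>lev a\<close>, which is the hypothesis of
  \<open>relabel_step\<close>.\<close>

lemma process_arc:
  assumes s: "static s" and a: "s ''a'' 0 = a" "a \<in> arcs D" "s ''col'' a = 0"
    and l: "s ''lev'' a < length as" and v: "part.valid k (s ''col'') (s ''lev'')"
  defines "s' \<equiv> result process_arc s"
  shows "part.valid k (s' ''col'') (s' ''lev'') \<and>
    part.potential (s' ''col'') (s' ''lev'') < part.potential (s ''col'') (s ''lev'')"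
proof -
  define col lev where "col = s ''col''" and "lev = s ''lev''"
  define P where "P = If (Equal (Cell ''done'') (Const 0)) try_class Noop"
  have W: "writes P = {''b'', ''x'', ''y'', ''v'', ''z'', ''T'', ''H'', ''g'', ''f'', ''j'', ''col'', ''done''}"
    by (auto simp: P_def writes_simps)
  define s0 where "s0 = store ''done'' 0 0 s"
  define s1 where "s1 = result (Count ''c'' ''k'' P) s0"
  define I where "I = (\<lambda>j t. (t ''done'' 0 = 0 \<and> t ''col'' = col \<and>
      (\<forall>i\<in>{1..j}. a \<in> bip.span {f \<in> part.colour_class col i. lev a \<le> lev f})) \<or>
    (t ''done'' 0 = 1 \<and> part.valid k (t ''col'') lev \<and>
      part.potential (t ''col'') lev < part.potential col lev))"
  have "I (s0 ''k'' 0) s1"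
    unfolding s1_def
  proof (rule result_Count[where I = I], goal_cases)
    case (6 j t)
    have fr: "t x = s x" if "x \<notin> {''b'', ''x'', ''y'', ''v'', ''z'', ''T'', ''H'', ''g'', ''f'', ''j'', ''col'', ''done'', ''c''}" for x
      using that 6(4)[of x] unfolding W by (simp add: s0_def)
    have st: "static t" by (rule static_in_loop[OF s], erule fr) (simp add: static_arrays_def)
    have jk: "j < k" using 6(1) s by (simp add: static_def s0_def)
    have P: "result P t = (if t ''done'' 0 = 0 then result try_class t else t)"
      unfolding P_def result.simps cond_Equal by simp
    show ?case
    proof (cases "t ''done'' 0 = 0")
      case False
      then show ?thesis using 6(2) P by (auto simp: I_def)
    next
      case True
      then have It: "t ''col'' = col" "\<forall>i\<in>{1..j}. a \<in> bip.span {f \<in> part.colour_class col i. lev a \<le> lev f}"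
        using 6(2) by (auto simp: I_def)
      have lev: "t ''lev'' = lev" using fr[of "''lev''"] by (simp add: lev_def)
      have "a \<in> bip.span {f \<in> part.colour_class (t ''col'') (Suc j). t ''lev'' a \<le> t ''lev'' f} \<and>
          result try_class t ''col'' = t ''col'' \<and> result try_class t ''done'' = t ''done'' \<or>
          part.valid k (result try_class t ''col'') (t ''lev'') \<and>
          part.potential (result try_class t ''col'') (t ''lev'') < part.potential (t ''col'') (t ''lev'') \<and>
          result try_class t ''done'' 0 = 1"
        by (rule try_class[OF st _ a(2) _ 6(3) jk])
          (use fr[of "''a''"] a It lev v in \<open>simp_all add: col_def lev_def\<close>)
      then show ?thesis
        using It True unfolding lev It(1) I_def P by (auto simp: le_Suc_eq)
    qed
  qed (simp_all add: W I_def s0_def col_def)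
  then have I: "I k s1" using s by (simp add: static_def s0_def)
  have fr: "s1 x = s x" if "x \<in> {''a'', ''lev''}" for x
    using result_frame[of x "Count ''c'' ''k'' P" s0] that unfolding s1_def by (auto simp: s0_def W)
  have s': "s' = (if s1 ''done'' 0 = 0 then store ''lev'' a (Suc (lev a)) s1 else s1)"
  proof -
    have "result (Assign ''done'' (Const 0)) s = s0" by (simp add: s0_def)
    then have "s' = result (If (Equal (Cell ''done'') (Const 0))
       (Store ''lev'' (Cell ''a'') (Plus (Read ''lev'' (Cell ''a'')) (Const 1))) Noop) s1"
      unfolding s'_def process_arc_def P_def[symmetric] s1_def by (simp only: result.simps(3))
    then show ?thesis using fr[of "''a''"] fr[of "''lev''"] a(1) by (simp add: lev_def)
  qed
  have v': "part.valid k col lev" using v by (simp add: col_def lev_def)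
  have a': "col a = 0" "lev a < card (arcs D)" using a l length_as by (simp_all add: col_def lev_def)
  have levs1: "s1 ''lev'' = lev" using fr by (simp add: lev_def)
  have "part.valid k (s' ''col'') (s' ''lev'') \<and> part.potential (s' ''col'') (s' ''lev'') < part.potential col lev"
  proof (cases "s1 ''done'' 0 = 0")
    case True
    then have "s' ''col'' = col" "s' ''lev'' = lev(a := Suc (lev a))"
      using I s' levs1 by (auto simp: I_def)
    moreover have "\<And>i. i \<in> {1..k} \<Longrightarrow> a \<in> bip.span {f \<in> part.colour_class col i. lev a \<le> lev f}"
      using I True by (auto simp: I_def)
    ultimately show ?thesis using part.relabel_step[OF v' a(2) a'] by simp
  next
    case False
    then show ?thesis using I s' levs1 by (auto simp: I_def)
  qed
  then show ?thesis by (simp add: col_def lev_def)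
qed

section \<open>The scan over all arcs\<close>

definition scan_invariant :: "memory \<Rightarrow> bool" where
  "scan_invariant s \<longleftrightarrow> static s \<and> part.valid k (s ''col'') (s ''lev'') \<and> s ''e'' 0 \<le> length as \<and>
     (\<forall>j < s ''e'' 0. s ''col'' (as ! j) = 0 \<longrightarrow> length as \<le> s ''lev'' (as ! j))"

text \<open>A lexicographic order as one number: a step resets the position but lowers the
  potential, whose weight exceeds any remaining distance.\<close>

definition scan_measure :: "memory \<Rightarrow> nat" where
  "scan_measure s = part.potential (s ''col'') (s ''lev'') * Suc (length as) + (length as - s ''e'' 0)"

lemma scan_arc:
  assumes "scan_invariant s" "s ''e'' 0 < length as"
  shows "scan_invariant (result scan_arc s)" "scan_measure (result scan_arc s) < scan_measure s"
proof -
  define a where "a = as ! (s ''e'' 0)"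
  define s1 where "s1 = store ''a'' 0 a s"
  have s: "static s" "part.valid k (s ''col'') (s ''lev'')"
    using assms(1) by (simp_all add: scan_invariant_def)
  have s1: "static s1" by (rule static_cong[OF s(1)]) (auto simp: s1_def static_arrays_def)
  have arc: "a \<in> arcs D" using nth_mem[OF assms(2)] unfolding set_as a_def .
  have res: "result scan_arc s = (if s ''col'' a = 0 \<and> s ''lev'' a < length as
      then store ''e'' 0 0 (result process_arc s1) else store ''e'' 0 (Suc (s ''e'' 0)) s1)"
    unfolding scan_arc_def result.simps cond_val.simps(3) cond_Equal
    using s(1) assms(2) by (simp add: static_def s1_def a_def)
  have "scan_invariant (result scan_arc s) \<and> scan_measure (result scan_arc s) < scan_measure s"
  proof (cases "s ''col'' a = 0 \<and> s ''lev'' a < length as")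
    case True
    define s2 where "s2 = result process_arc s1"
    have "part.valid k (s2 ''col'') (s2 ''lev'') \<and>
        part.potential (s2 ''col'') (s2 ''lev'') < part.potential (s1 ''col'') (s1 ''lev'')"
      unfolding s2_def
      by (rule process_arc[OF s1 _ arc]) (use True s in \<open>simp_all add: s1_def\<close>)
    then have p: "part.valid k (s2 ''col'') (s2 ''lev'')"
        "part.potential (s2 ''col'') (s2 ''lev'') < part.potential (s ''col'') (s ''lev'')"
      by (simp_all add: s1_def)
    have "static s2" unfolding s2_def
      by (rule static_result[OF s1]) (simp add: writes_simps static_arrays_def)
    then have "static (store ''e'' 0 0 s2)"
      by (rule static_cong) (auto simp: static_arrays_def)
    moreover have "Suc (part.potential (s2 ''col'') (s2 ''lev'')) * Suc (length as) \<le>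
        part.potential (s ''col'') (s ''lev'') * Suc (length as)"
      using p(2) by (intro mult_le_mono1) simp
    ultimately show ?thesis using p True
      by (simp add: res scan_invariant_def scan_measure_def flip: s2_def)
  next
    case False
    have "static (store ''e'' 0 (Suc (s ''e'' 0)) s1)"
      by (rule static_cong[OF s1]) (auto simp: static_arrays_def)
    moreover have "\<forall>j < Suc (s ''e'' 0). s ''col'' (as ! j) = 0 \<longrightarrow> length as \<le> s ''lev'' (as ! j)"
      using assms(1) False by (auto simp: less_Suc_eq scan_invariant_def a_def)
    ultimately show ?thesis using False assms s unfolding res if_not_P[OF False]
      by (simp add: scan_invariant_def scan_measure_def s1_def)
  qed
  then show "scan_invariant (result scan_arc s)" "scan_measure (result scan_arc s) < scan_measure s"
    by blast+
qed

end

section \<open>Packings and classes\<close>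

lemma bip_connected_arcs_update: "bip_connected (D\<lparr>arcs := A\<rparr>) X \<longleftrightarrow> bip_connected D X"
  by (simp add: bip_connected_def)

lemma spanning_arcs_update:
  assumes "wf_digraph D" "A \<subseteq> arcs D"
  shows "wf_digraph (D\<lparr>arcs := A\<rparr>)" "spanning (D\<lparr>arcs := A\<rparr>) D"
  using assms by (auto simp: spanning_def subgraph_def wf_digraph_def compatible_def)

lemma antistrong_arcs_update:
  assumes "wf_digraph D" "A \<subseteq> arcs D" "3 \<le> card (verts D)" "bip_connected D A"
  shows "antistrong (D\<lparr>arcs := A\<rparr>)"
  using assms antistrong_iff_bip_connected[OF spanning_arcs_update(1)[OF assms(1,2)]]
  by (simp add: bip_connected_arcs_update)

text \<open>A subdigraph inherits the ends of its arcs from \<open>D\<close>, so its connectivity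
  can be judged in \<open>D\<close>.\<close>

lemma spanning_antistrong:
  assumes "spanning H D" "antistrong H"
  shows "3 \<le> card (verts D)" "arcs H \<subseteq> arcs D" "bip_connected D (arcs H)"
proof -
  have "wf_digraph H" "verts H = verts D" "tail H = tail D" "head H = head D" "arcs H \<subseteq> arcs D"
    using assms(1) by (auto simp: spanning_def subgraph_def compatible_def)
  then show "3 \<le> card (verts D)" "arcs H \<subseteq> arcs D" "bip_connected D (arcs H)"
    using assms(2) antistrong_iff_bip_connected[of H] by (simp_all add: bip_connected_def)
qed

lemma bip_connected_nonempty:
  assumes "3 \<le> card (verts D)" "bip_connected D X"
  shows "X \<noteq> {}"
proof
  assume "X = {}"
  moreover obtain x where "x \<in> verts D" using assms(1) by fastforce
  then have "bip_conn D X (x, True) (x, False)" using assms(2) by (simp add: bip_connected_def)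
  ultimately show False by (simp add: edge_ends.conn_empty)
qed

context coded_digraph
begin

lemma finite_arcs: "finite (arcs D)"
  by (rule part.finite_E)

lemma bip_connectedD:
  "bip_connected D X \<Longrightarrow> p \<in> verts D \<times> UNIV \<Longrightarrow> q \<in> verts D \<times> UNIV \<Longrightarrow> bip.conn X p q"
  unfolding bip_connected_def by blast

lemma bip_connected_span: "bip_connected D X \<Longrightarrow> arcs D \<subseteq> bip.span X"
  by (auto simp: bip.span_def intro: bip_connectedD)

section \<open>Consequences of the existence of a packing\<close>

lemma packing_nth:
  assumes "antistrong_packing D k Hs" "i < k"
  shows "3 \<le> card (verts D)" "arcs (Hs ! i) \<subseteq> arcs D" "bip_connected D (arcs (Hs ! i))"
  using assms spanning_antistrong[of "Hs ! i" D] by (simp_all add: antistrong_packing_def)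

text \<open>\<open>valid_optimal\<close> yields that the class spans all arcs of \<open>D\<close>.
  Connectivity follows because these include the arcs of a member of the packing, which connect all
  vertex copies. Colours start at 1, list positions at 0.\<close>

lemma packing_imp_connected:
  assumes p: "antistrong_packing D k Hs" and v: "part.valid k c l"
    and stuck: "\<And>e. e \<in> arcs D \<Longrightarrow> c e = 0 \<Longrightarrow> card (arcs D) \<le> l e"
    and j: "j \<in> {1..k}"
  shows "bip_connected D (part.colour_class c j)"
proof -
  have i: "i - 1 < k" if "i \<in> {1..k}" for i using that by auto
  have "arcs D \<subseteq> bip.span (part.colour_class c j)"
  proof (rule part.valid_optimal[OF v stuck _ _ j, where T = "\<lambda>i. arcs (Hs ! (i - 1))"], goal_cases)
    case (3 i)
    then show ?case using packing_nth[OF p i] bip_connected_span by blast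
  next
    case (4 i j)
    then have "i - 1 \<noteq> j - 1" by auto
    then show ?case using p i 4 by (simp add: antistrong_packing_def)
  qed
  then have "arcs (Hs ! (j - 1)) \<subseteq> bip.span (part.colour_class c j)"
    using packing_nth(2)[OF p i[OF j]] by blast
  then show ?thesis
    using packing_nth(3)[OF p i[OF j]] bip.conn_span_subset unfolding bip_connected_def by blast
qed

text \<open>The members have disjoint nonempty arc sets. This justifies rejecting large
  \<open>k\<close> at once: \<open>k\<close> is given in binary, so loops up to an unchecked
  \<open>k\<close> could take exponential time.\<close>

lemma packing_bounds:
  assumes p: "antistrong_packing D k Hs" and "0 < k"
  shows "3 \<le> length vs" "k \<le> length as"
proof -
  have "card (verts D) = length vs" using distinct_card[OF distinct_vs] set_vs by simp
  then show "3 \<le> length vs" using packing_nth(1)[OF p assms(2)] by simp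
  have "k = (\<Sum>i\<in>{..<k}. 1)" by simp
  also have "\<dots> \<le> (\<Sum>i\<in>{..<k}. card (arcs (Hs ! i)))"
  proof (rule sum_mono)
    fix i assume i: "i \<in> {..<k}"
    then have i: "i < k" by simp
    have "arcs (Hs ! i) \<noteq> {}"
      by (rule bip_connected_nonempty[OF packing_nth(1,3)[OF p i]])
    moreover have "finite (arcs (Hs ! i))"
      by (rule finite_subset[OF packing_nth(2)[OF p i] finite_arcs])
    ultimately show "1 \<le> card (arcs (Hs ! i))" by (simp add: Suc_le_eq card_gt_0_iff)
  qed
  also have "\<dots> = card (\<Union>i\<in>{..<k}. arcs (Hs ! i))"
  proof (rule card_UN_disjoint[symmetric])
    show "\<forall>i\<in>{..<k}. finite (arcs (Hs ! i))"
      using finite_subset[OF packing_nth(2)[OF p] finite_arcs] by simp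
    show "\<forall>i\<in>{..<k}. \<forall>j\<in>{..<k}. i \<noteq> j \<longrightarrow> arcs (Hs ! i) \<inter> arcs (Hs ! j) = {}"
      using p by (simp add: antistrong_packing_def)
  qed simp
  also have "\<dots> \<le> length as"
    unfolding length_as using packing_nth(2)[OF p] by (intro card_mono[OF finite_arcs] UN_least) simp
  finally show "k \<le> length as" .
qed

section \<open>Encoding of the classes in the output\<close>

definition class_code :: "(nat \<Rightarrow> nat) \<Rightarrow> nat \<Rightarrow> nat list" where
  "class_code c i = (let bs = filter (\<lambda>a. c a = i) as in
     [length vs, length bs] @ vs @ concat (map (\<lambda>a. [a, tail D a, head D a]) bs))"

definition classes_code :: "(nat \<Rightarrow> nat) \<Rightarrow> nat \<Rightarrow> nat list" where
  "classes_code c j = 1 # concat (map (\<lambda>i. class_code c (Suc i)) [0..<j])"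

definition class_digraphs :: "(nat \<Rightarrow> nat) \<Rightarrow> (nat, nat) pre_digraph list" where
  "class_digraphs c = map (\<lambda>i. D\<lparr>arcs := part.colour_class c (Suc i)\<rparr>) [0..<k]"

lemma class_digraphs_packing:
  assumes "\<And>i. i \<in> {1..k} \<Longrightarrow> bip_connected D (part.colour_class c i)" "0 < k \<Longrightarrow> 3 \<le> length vs"
  shows "antistrong_packing D k (class_digraphs c)"
proof -
  have "card (verts D) = length vs" using distinct_card[OF distinct_vs] set_vs by simp
  moreover have "part.colour_class c i \<subseteq> arcs D" for i by (auto simp: part.colour_class_def)
  ultimately have "spanning (D\<lparr>arcs := part.colour_class c (Suc i)\<rparr>) D \<and>
      antistrong (D\<lparr>arcs := part.colour_class c (Suc i)\<rparr>)" if "i < k" for i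
    using that assms spanning_arcs_update(2)[OF wf_D] antistrong_arcs_update[OF wf_D] by simp
  moreover have "part.colour_class c i \<inter> part.colour_class c j = {}" if "i \<noteq> j" for i j
    using that by (auto simp: part.colour_class_def)
  ultimately show ?thesis by (auto simp: antistrong_packing_def class_digraphs_def)
qed

lemma class_digraphs_code:
  "list_all2 digraph_code (class_digraphs c) (map (\<lambda>i. class_code c (Suc i)) [0..<k])"
proof -
  have "digraph_code (D\<lparr>arcs := part.colour_class c i\<rparr>) (class_code c i)" for i
  proof -
    have "set (filter (\<lambda>a. c a = i) as) = part.colour_class c i"
      unfolding set_filter set_as by (simp add: part.colour_class_def)
    moreover have "distinct (filter (\<lambda>a. c a = i) as)" using distinct_as by simp
    ultimately show ?thesis
      unfolding digraph_code_def class_code_def Let_def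
      by (intro exI[of _ vs] exI[of _ "filter (\<lambda>a. c a = i) as"]) (simp add: distinct_vs set_vs)
  qed
  then show ?thesis by (simp add: class_digraphs_def list_all2_conv_all_nth)
qed

lemma length_class_code: "length (class_code c i) \<le> 2 + length vs + 3 * length as"
proof -
  have "length (concat (map (\<lambda>a. [a, tail D a, head D a]) bs)) = 3 * length bs" for bs
    by (induction bs) auto
  then show ?thesis
    using length_filter_le[of "\<lambda>a. c a = i" as] by (simp add: class_code_def Let_def)
qed

text \<open>For the running time, which includes reading the output.\<close>

lemma length_classes_code: "length (classes_code c j) \<le> 1 + j * (2 + length vs + 3 * length as)"
proof (induction j)
  case (Suc j)
  then show ?case using length_class_code[of c "Suc j"] by (simp add: classes_code_def)
qed (simp add: classes_code_def)

end

section \<open>Checking and printing the classes\<close>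

definition check_classes :: counting where
  "check_classes = Assign ''ok'' (Const 1) ;;
     Count ''c'' ''k''
       (init_labels ;; merge_arcs in_class ;;
        Count ''v'' ''n''
          (Assign ''z'' (Read ''vs'' (Cell ''v'')) ;;
           If (Conj (Equal (Read ''T'' (Cell ''z'')) (Read ''T'' (Cell ''vs'')))
                (Equal (Read ''H'' (Cell ''z'')) (Read ''T'' (Cell ''vs''))))
             Noop (Assign ''ok'' (Const 0))))"

definition emit :: "expr \<Rightarrow> counting" where
  "emit e = Assign ''p'' (Plus (Cell ''p'') (Const 1)) ;; Store ''out'' (Cell ''p'') e"

text \<open>The code of a digraph gives the number of arcs before the arcs themselves, hence this
  separate pass.\<close>

definition count_class :: counting where
  "count_class = Assign ''q'' (Const 0) ;;
     Count ''j'' ''m''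
       (Assign ''b'' (Read ''as'' (Cell ''j'')) ;;
        If in_class (Assign ''q'' (Plus (Cell ''q'') (Const 1))) Noop)"

definition emit_verts :: counting where
  "emit_verts = Count ''v'' ''n'' (emit (Read ''vs'' (Cell ''v'')))"

definition emit_arcs :: counting where
  "emit_arcs = Count ''j'' ''m''
     (Assign ''b'' (Read ''as'' (Cell ''j'')) ;;
      If in_class
        (emit (Cell ''b'') ;; emit (Read ''tl'' (Cell ''b'')) ;; emit (Read ''hd'' (Cell ''b''))) Noop)"

definition emit_classes :: counting where
  "emit_classes = Assign ''p'' (Const 0) ;; emit (Const 1) ;;
     Count ''c'' ''k''
       (count_class ;; emit (Cell ''n'') ;; emit (Cell ''q'') ;; emit_verts ;; emit_arcs) ;;
     Store ''out'' (Const 0) (Cell ''p'')"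

definition reject :: counting where
  "reject = Store ''out'' (Const 0) (Const 1) ;; Store ''out'' (Const 1) (Const 0)"

definition finish :: counting where
  "finish = check_classes ;; If (Equal (Cell ''ok'') (Const 1)) emit_classes reject"

lemmas finish_simps = check_classes_def emit_def count_class_def emit_verts_def emit_arcs_def
  emit_classes_def reject_def finish_def

text \<open>Cell 0 of \<open>''out''\<close> is left open: it receives the length only at the
  end.\<close>

definition written :: "memory \<Rightarrow> nat list \<Rightarrow> bool" where
  "written s ys \<longleftrightarrow> s ''p'' 0 = length ys \<and> (\<forall>i<length ys. s ''out'' (Suc i) = ys ! i)"

lemma written_cong: "written s ys \<Longrightarrow> s' ''p'' = s ''p'' \<Longrightarrow> s' ''out'' = s ''out'' \<Longrightarrow> written s' ys"
  by (simp add: written_def)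

text \<open>The expression is evaluated after \<open>''p''\<close> has been advanced, hence the
  updated memory in the second assumption.\<close>

lemma written_emit:
  assumes "written s ys" "expr_val e (store ''p'' 0 (Suc (s ''p'' 0)) s) = v"
  shows "written (result (emit e) s) (ys @ [v])"
proof -
  define s1 where "s1 = store ''p'' 0 (Suc (s ''p'' 0)) s"
  have "result (Assign ''p'' (Plus (Cell ''p'') (Const 1))) s = s1" by (simp add: s1_def)
  then have "result (emit e) s = store ''out'' (s1 ''p'' 0) v s1"
    using assms(2) unfolding emit_def result.simps(3) s1_def by simp
  moreover have "s1 ''p'' 0 = Suc (length ys)" "s1 ''out'' = s ''out''"
    using assms(1) by (simp_all add: s1_def written_def)
  ultimately show ?thesis
    using assms(1) by (auto simp: written_def nth_append less_Suc_eq)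
qed

lemma output_list_written:
  assumes "written s ys"
  shows "output_list (store ''out'' 0 (s ''p'' 0) s) = ys"
  using assms unfolding output_list_def written_def
  by (intro nth_equalityI) (auto simp del: upt_Suc)

context coded_digraph
begin

lemma check_classes:
  assumes s: "static s"
  shows "result check_classes s ''ok'' 0 = 1 \<longleftrightarrow>
    (\<forall>i\<in>{1..k}. bip_connected D (part.colour_class (s ''col'') i))"
proof -
  define col where "col = s ''col''"
  define Q where "Q = Count ''v'' ''n''
          (Assign ''z'' (Read ''vs'' (Cell ''v'')) ;;
           If (Conj (Equal (Read ''T'' (Cell ''z'')) (Read ''T'' (Cell ''vs'')))
                (Equal (Read ''H'' (Cell ''z'')) (Read ''T'' (Cell ''vs''))))
             Noop (Assign ''ok'' (Const 0)))"
  define P where "P = init_labels ;; merge_arcs in_class ;; Q"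
  define s0 where "s0 = store ''ok'' 0 1 s"
  have W: "writes P = {''b'', ''x'', ''y'', ''v'', ''z'', ''T'', ''H'', ''j'', ''ok''}"
    by (auto simp: P_def Q_def writes_simps)
  have Q: "result Q t ''ok'' 0 = 1 \<longleftrightarrow> t ''ok'' 0 = 1 \<and> bip_connected D X"
    if t: "static t" "labels t X" for t X
  proof -
    \<comment> \<open>The reference label is that of the copy marked \<open>True\<close> of the
      first listed vertex.\<close>
    define r where "r = t ''T'' (t ''vs'' 0)"
    let ?I = "\<lambda>j u. u ''ok'' 0 = 1 \<longleftrightarrow>
      t ''ok'' 0 = 1 \<and> (\<forall>i<j. t ''T'' (vs ! i) = r \<and> t ''H'' (vs ! i) = r)"
    have "?I (t ''n'' 0) (result Q t)"
      unfolding Q_def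
    proof (rule result_Count[where I = ?I], goal_cases)
      case (6 j u)
      have fr: "u x = t x" if "x \<notin> {''z'', ''ok'', ''v''}" for x
        using 6(4)[of x] that by simp
      have "static u" by (rule static_in_loop[OF t(1)], erule fr) (simp add: static_arrays_def)
      then have "u ''vs'' j = vs ! j" using 6(1) t(1) by (simp add: static_def)
      then show ?case
        using 6(2,3) fr[of "''T''"] fr[of "''H''"] fr[of "''vs''"] by (auto simp: r_def less_Suc_eq)
    qed simp_all
    then have *: "result Q t ''ok'' 0 = 1 \<longleftrightarrow>
        t ''ok'' 0 = 1 \<and> (\<forall>i<length vs. t ''T'' (vs ! i) = r \<and> t ''H'' (vs ! i) = r)"
      using t(1) by (simp add: static_def)
    have "(\<forall>i<length vs. t ''T'' (vs ! i) = r \<and> t ''H'' (vs ! i) = r) \<longleftrightarrow> bip_connected D X"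
    proof
      assume "\<forall>i<length vs. t ''T'' (vs ! i) = r \<and> t ''H'' (vs ! i) = r"
      then have "label t p = r" if "p \<in> verts D \<times> UNIV" for p
        using label_pointwise[where f = "\<lambda>l v b. l = r", OF _ that] by simp
      then show "bip_connected D X" using t(2) unfolding bip_connected_def labels_def by metis
    next
      assume c: "bip_connected D X"
      show "\<forall>i<length vs. t ''T'' (vs ! i) = r \<and> t ''H'' (vs ! i) = r"
      proof (intro allI impI)
        fix i assume i: "i < length vs"
        then have "0 < length vs" by linarith
        then have vs0: "t ''vs'' 0 = vs ! 0" "vs ! 0 \<in> verts D"
          using t(1) nth_mem[of 0 vs] unfolding set_vs by (simp_all add: static_def)
        have "vs ! i \<in> verts D" using nth_mem[OF i] unfolding set_vs .
        then have "label t (vs ! i, b) = label t (vs ! 0, True)" for b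
          using t(2) vs0(2) bip_connectedD[OF c] by (simp add: labels_def)
        from this[of True] this[of False]
        show "t ''T'' (vs ! i) = r \<and> t ''H'' (vs ! i) = r" by (simp add: label_def r_def vs0(1))
      qed
    qed
    then show ?thesis using * by simp
  qed
  let ?I = "\<lambda>j t. t ''ok'' 0 = 1 \<longleftrightarrow> (\<forall>i\<in>{1..j}. bip_connected D (part.colour_class col i))"
  have "?I (s0 ''k'' 0) (result (Count ''c'' ''k'' P) s0)"
  proof (rule result_Count[where I = ?I], goal_cases)
    case (6 j t)
    have fr: "t x = s x" if "x \<notin> {''b'', ''x'', ''y'', ''v'', ''z'', ''T'', ''H'', ''j'', ''ok'', ''c''}" for x
      using that 6(4)[of x] unfolding W by (simp add: s0_def)
    have st: "static t" by (rule static_in_loop[OF s], erule fr) (simp add: static_arrays_def)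
    define t1 where "t1 = result init_labels t"
    define t2 where "t2 = result (merge_arcs in_class) t1"
    have st1: "static t1" unfolding t1_def
      by (rule static_result[OF st]) (simp add: writes_simps static_arrays_def)
    have st2: "static t2" unfolding t2_def
      by (rule static_result[OF st1]) (simp add: writes_simps static_arrays_def)
    have t1: "t1 ''col'' = col" "t1 ''c'' 0 = j" "t1 ''ok'' = t ''ok''"
      using fr[of "''col''"] 6(3) result_frame[of "''col''" init_labels t]
        result_frame[of "''c''" init_labels t] result_frame[of "''ok''" init_labels t]
      unfolding t1_def by (simp_all add: writes_simps col_def)
    have ok: "t2 ''ok'' = t ''ok''"
      using t1(3) unfolding t2_def by (subst result_frame) (simp_all add: writes_simps)
    have l1: "labels t1 {}" unfolding t1_def by (rule labels_init[OF st])
    have "labels t2 {b \<in> arcs D. col b = Suc j}"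
      unfolding t2_def
    proof (rule labels_merge_arcs[OF st1 l1], goal_cases)
      case (1 u)
      have "u ''col'' = t1 ''col''" "u ''c'' = t1 ''c''"
        using 1(1)[of "''col''"] 1(1)[of "''c''"] by (simp_all add: merge_labels_def)
      then show ?case using t1 by simp
    qed
    then have "labels t2 (part.colour_class col (Suc j))" by (simp add: part.colour_class_def)
    from Q[OF st2 this] have "result P t ''ok'' 0 = 1 \<longleftrightarrow>
        t ''ok'' 0 = 1 \<and> bip_connected D (part.colour_class col (Suc j))"
      unfolding P_def result.simps(3) t1_def[symmetric] t2_def[symmetric] ok .
    then show ?case using 6(2) by (auto simp: le_Suc_eq)
  qed (simp_all add: W s0_def)
  moreover have "s0 ''k'' 0 = k" using s by (simp add: static_def s0_def)
  moreover have "result check_classes s = result (Count ''c'' ''k'' P) s0"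
    unfolding check_classes_def P_def Q_def by (simp add: s0_def)
  ultimately show ?thesis by (simp add: col_def)
qed

end

section \<open>Input and output\<close>

context coded_digraph
begin

lemma emit_verts:
  assumes s: "static s" and w: "written s ys"
  shows "written (result emit_verts s) (ys @ vs)"
proof -
  let ?I = "\<lambda>j t. written t (ys @ take j vs)"
  have "?I (s ''n'' 0) (result emit_verts s)"
    unfolding emit_verts_def
  proof (rule result_Count[where I = ?I], goal_cases)
    case (4 j t v)
    show ?case by (simp add: written_def)
  next
    case (6 j t)
    have j: "j < length vs" "t ''vs'' j = vs ! j"
      using 6(1) s 6(4)[of "''vs''"] by (simp_all add: static_def emit_def)
    have "written (result (emit (Read ''vs'' (Cell ''v''))) t) ((ys @ take j vs) @ [vs ! j])"
      by (rule written_emit[OF 6(2)]) (simp add: 6(3) j)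
    then show ?case by (simp only: take_Suc_conv_app_nth[OF j(1)] append_assoc)
  qed (use w in \<open>simp_all add: emit_def\<close>)
  then show ?thesis using s by (simp add: static_def)
qed

lemma count_class:
  assumes s: "static s"
  shows "result count_class s ''q'' 0 = length (filter (\<lambda>a. s ''col'' a = Suc (s ''c'' 0)) as)"
proof -
  define P where "P = Assign ''b'' (Read ''as'' (Cell ''j'')) ;;
        If in_class (Assign ''q'' (Plus (Cell ''q'') (Const 1))) Noop"
  define s0 where "s0 = store ''q'' 0 0 s"
  let ?f = "filter (\<lambda>a. s ''col'' a = Suc (s ''c'' 0))"
  let ?I = "\<lambda>j t. t ''q'' 0 = length (?f (take j as))"
  have "?I (s0 ''m'' 0) (result (Count ''j'' ''m'' P) s0)"
  proof (rule result_Count[where I = ?I], goal_cases)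
    case (6 j t)
    have j: "j < length as" using 6(1) s by (simp add: static_def s0_def)
    have fr: "t x = s x" if "x \<in> {''as'', ''col'', ''c''}" for x
      using that 6(4)[of x] by (auto simp: s0_def P_def)
    have "t ''as'' j = as ! j" using fr j s by (simp add: static_def)
    then show ?case using 6(2,3) j fr by (simp add: P_def take_Suc_conv_app_nth)
  qed (simp_all add: P_def s0_def)
  moreover have "s0 ''m'' 0 = length as" using s by (simp add: static_def s0_def)
  moreover have "result count_class s = result (Count ''j'' ''m'' P) s0"
    by (simp add: count_class_def P_def s0_def)
  ultimately show ?thesis by simp
qed

lemma emit_arcs:
  assumes s: "static s" and w: "written s ys"
  shows "written (result emit_arcs s) (ys @ concat (map (\<lambda>a. [a, tail D a, head D a])
    (filter (\<lambda>a. s ''col'' a = Suc (s ''c'' 0)) as)))"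
proof -
  define E where "E = emit (Cell ''b'') ;; emit (Read ''tl'' (Cell ''b'')) ;; emit (Read ''hd'' (Cell ''b''))"
  define P where "P = Assign ''b'' (Read ''as'' (Cell ''j'')) ;; If in_class E Noop"
  let ?f = "filter (\<lambda>a. s ''col'' a = Suc (s ''c'' 0))"
  let ?g = "\<lambda>a. [a, tail D a, head D a]"
  let ?I = "\<lambda>j t. written t (ys @ concat (map ?g (?f (take j as))))"
  have W: "writes P = {''b'', ''p'', ''out''}" by (auto simp: P_def E_def emit_def)
  have "?I (s ''m'' 0) (result (Count ''j'' ''m'' P) s)"
  proof (rule result_Count[where I = ?I], goal_cases)
    case (4 j t v)
    show ?case by (simp add: written_def)
  next
    case (6 j t)
    have j: "j < length as" using 6(1) s by (simp add: static_def)
    define b where "b = as ! j"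
    have arc: "b \<in> arcs D" using nth_mem[OF j] unfolding set_as b_def .
    have fr: "t x = s x" if "x \<in> {''as'', ''col'', ''c'', ''tl'', ''hd''}" for x
      using that 6(4)[of x] unfolding W by auto
    define t1 where "t1 = store ''b'' 0 b t"
    have "result (Assign ''b'' (Read ''as'' (Cell ''j''))) t = t1"
      using fr j s by (simp add: static_def 6(3) t1_def b_def)
    moreover have "cond_val in_class t1 \<longleftrightarrow> s ''col'' b = Suc (s ''c'' 0)"
      using fr by (simp add: t1_def)
    ultimately have res: "result P t = (if s ''col'' b = Suc (s ''c'' 0) then result E t1 else t1)"
      unfolding P_def by (simp only: result.simps(1,3,4))
    have w1: "written t1 (ys @ concat (map ?g (?f (take j as))))"
      by (rule written_cong[OF 6(2)]) (simp_all add: t1_def)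
    have ends: "t1 ''tl'' b = tail D b" "t1 ''hd'' b = head D b" "t1 ''b'' 0 = b"
      using fr s arc by (simp_all add: static_def t1_def)
    define t2 where "t2 = result (emit (Cell ''b'')) t1"
    define t3 where "t3 = result (emit (Read ''tl'' (Cell ''b''))) t2"
    have fr2: "t2 x = t1 x" "t3 x = t1 x" if "x \<in> {''b'', ''tl'', ''hd''}" for x
      using that result_frame[of x "emit (Cell ''b'')" t1]
        result_frame[of x "emit (Read ''tl'' (Cell ''b''))" t2]
      unfolding t3_def t2_def by (auto simp: emit_def)
    let ?ws = "ys @ concat (map ?g (?f (take j as)))"
    have "written t2 (?ws @ [b])"
      unfolding t2_def by (rule written_emit[OF w1]) (simp add: ends)
    then have "written t3 ((?ws @ [b]) @ [tail D b])"
      unfolding t3_def by (rule written_emit) (simp add: ends fr2)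
    then have "written (result (emit (Read ''hd'' (Cell ''b''))) t3) (((?ws @ [b]) @ [tail D b]) @ [head D b])"
      by (rule written_emit) (simp add: ends fr2)
    then have E: "written (result E t1) (?ws @ ?g b)"
      unfolding E_def result.simps(3) t2_def[symmetric] t3_def[symmetric] by simp
    show ?case
    proof (cases "s ''col'' b = Suc (s ''c'' 0)")
      case True
      then have "?ws @ ?g b = ys @ concat (map ?g (?f (take (Suc j) as)))"
        using j by (simp add: take_Suc_conv_app_nth b_def)
      then show ?thesis using E True res by simp
    next
      case False
      then have "?f (take (Suc j) as) = ?f (take j as)"
        using j by (simp add: take_Suc_conv_app_nth b_def)
      then show ?thesis using w1 False res by simp
    qed
  qed (use w in \<open>simp_all add: W\<close>)
  then show ?thesis using s unfolding emit_arcs_def P_def E_def by (simp add: static_def)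
qed

lemma emit_classes:
  assumes s: "static s"
  shows "output_list (result emit_classes s) = classes_code (s ''col'') k"
proof -
  define P where "P = count_class ;; emit (Cell ''n'') ;; emit (Cell ''q'') ;; emit_verts ;; emit_arcs"
  define s0 where "s0 = result (emit (Const 1)) (store ''p'' 0 0 s)"
  have W: "writes P = {''b'', ''p'', ''q'', ''out'', ''j'', ''v''}"
    by (auto simp: P_def finish_simps)
  have fr0: "s0 x = s x" if "x \<notin> {''p'', ''out''}" for x
    using that result_frame[of x "emit (Const 1)" "store ''p'' 0 0 s"]
    unfolding s0_def by (simp add: emit_def)
  have "written (store ''p'' 0 0 s) []" by (simp add: written_def)
  then have "written s0 ([] @ [1])" unfolding s0_def by (rule written_emit) simp
  then have w0: "written s0 (classes_code (s ''col'') 0)" by (simp add: classes_code_def)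
  have st0: "static s0" by (rule static_in_loop[OF s], erule fr0) (simp add: static_arrays_def)
  let ?I = "\<lambda>j t. written t (classes_code (s ''col'') j)"
  have "?I (s0 ''k'' 0) (result (Count ''c'' ''k'' P) s0)"
  proof (rule result_Count[where I = ?I], goal_cases)
    case (4 j t v)
    show ?case by (simp add: written_def)
  next
    case (6 j t)
    define bs where "bs = filter (\<lambda>a. s ''col'' a = Suc j) as"
    define t1 where "t1 = result count_class t"
    define t2 where "t2 = result (emit (Cell ''n'')) t1"
    define t3 where "t3 = result (emit (Cell ''q'')) t2"
    define t4 where "t4 = result emit_verts t3"
    have fr: "t x = s x" if "x \<notin> {''b'', ''p'', ''q'', ''out'', ''j'', ''v'', ''c''}" for x
      using that 6(4)[of x] fr0[of x] unfolding W by simp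
    have st: "static t" by (rule static_in_loop[OF s], erule fr) (simp add: static_arrays_def)
    have st1: "static t1" unfolding t1_def
      by (rule static_result[OF st]) (simp add: finish_simps static_arrays_def)
    have st2: "static t2" unfolding t2_def
      by (rule static_result[OF st1]) (simp add: finish_simps static_arrays_def)
    have st3: "static t3" unfolding t3_def
      by (rule static_result[OF st2]) (simp add: finish_simps static_arrays_def)
    have st4: "static t4" unfolding t4_def
      by (rule static_result[OF st3]) (simp add: finish_simps static_arrays_def)
    have c: "t4 ''c'' = t ''c''" "t4 ''col'' = s ''col''" "t2 ''q'' = t1 ''q''"
      using result_frame[of "''c''" count_class t] result_frame[of "''c''" "emit (Cell ''n'')" t1]
        result_frame[of "''c''" "emit (Cell ''q'')" t2] result_frame[of "''c''" emit_verts t3]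
        result_frame[of "''col''" count_class t] result_frame[of "''col''" "emit (Cell ''n'')" t1]
        result_frame[of "''col''" "emit (Cell ''q'')" t2] result_frame[of "''col''" emit_verts t3]
        result_frame[of "''q''" "emit (Cell ''n'')" t1] fr[of "''col''"]
      unfolding t4_def t3_def t2_def t1_def by (simp_all add: finish_simps)
    have "t1 ''p'' = t ''p''" "t1 ''out'' = t ''out''"
      unfolding t1_def by (rule result_frame, simp add: finish_simps)+
    then have "written t1 (classes_code (s ''col'') j)" using written_cong[OF 6(2)] by blast
    then have "written t2 (classes_code (s ''col'') j @ [length vs])"
      unfolding t2_def by (rule written_emit) (use st1 in \<open>simp add: static_def\<close>)
    then have "written t3 ((classes_code (s ''col'') j @ [length vs]) @ [length bs])"
      unfolding t3_def
    proof (rule written_emit)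
      have "t1 ''q'' 0 = length bs"
        using count_class[OF st] fr[of "''col''"] unfolding t1_def bs_def 6(3) by simp
      then show "expr_val (Cell ''q'') (store ''p'' 0 (Suc (t2 ''p'' 0)) t2) = length bs"
        using c by simp
    qed
    from emit_verts[OF st3 this]
    have "written t4 (((classes_code (s ''col'') j @ [length vs]) @ [length bs]) @ vs)"
      unfolding t4_def .
    from emit_arcs[OF st4 this]
    have "written (result emit_arcs t4) (((((classes_code (s ''col'') j @ [length vs]) @ [length bs]) @ vs)
        @ concat (map (\<lambda>a. [a, tail D a, head D a]) bs)))"
      unfolding c 6(3) bs_def[symmetric] .
    then show ?case
      unfolding P_def result.simps(3) t1_def[symmetric] t2_def[symmetric] t3_def[symmetric] t4_def[symmetric]
      by (simp add: classes_code_def class_code_def Let_def bs_def)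
  qed (use w0 in \<open>simp_all add: W\<close>)
  moreover have "s0 ''k'' 0 = k" using st0 by (simp add: static_def)
  ultimately have "written (result (Count ''c'' ''k'' P) s0) (classes_code (s ''col'') k)" by simp
  from output_list_written[OF this] show ?thesis
    unfolding emit_classes_def result.simps(3) P_def s0_def by simp
qed

lemma finish_yes:
  assumes s: "static s"
    and c: "\<forall>i\<in>{1..k}. bip_connected D (part.colour_class (s ''col'') i)"
  shows "output_list (result finish s) = classes_code (s ''col'') k"
proof -
  define t where "t = result check_classes s"
  have "static t" unfolding t_def
    by (rule static_result[OF s]) (simp add: finish_simps writes_simps static_arrays_def)
  moreover have "t ''ok'' 0 = 1" unfolding t_def using check_classes[OF s] c by blast
  moreover have "t ''col'' = s ''col''" unfolding t_def
    by (rule result_frame) (simp add: finish_simps writes_simps)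
  ultimately show ?thesis using emit_classes[of t]
    unfolding finish_def result.simps t_def[symmetric] by simp
qed

end

lemma output_list_reject: "output_list (result reject s) = [0]"
  by (simp add: reject_def output_list_def)

context coded_digraph
begin

lemma finish_no:
  assumes s: "static s"
    and c: "\<not> (\<forall>i\<in>{1..k}. bip_connected D (part.colour_class (s ''col'') i))"
  shows "output_list (result finish s) = [0]"
proof -
  have "result check_classes s ''ok'' 0 \<noteq> 1" using check_classes[OF s] c by blast
  then show ?thesis unfolding finish_def result.simps(3,4) cond_Equal
    using output_list_reject by simp
qed

end

section \<open>Reading the input\<close>

definition load :: counting where
  "load = Assign ''k'' (Read ''in'' (Const 1)) ;; Assign ''n'' (Read ''in'' (Const 2)) ;;
     Assign ''m'' (Read ''in'' (Const 3))"

text \<open>The vertices start at cell 4 and the triple of arc number \<open>j\<close> at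
  \<open>n + 4 + 3 * j\<close>, with tripling done by addition. \<open>''tl''\<close> and
  \<open>''hd''\<close> are indexed by the arc itself, not by its position.\<close>

definition unpack :: counting where
  "unpack =
     Count ''v'' ''n'' (Store ''vs'' (Cell ''v'') (Read ''in'' (Plus (Cell ''v'') (Const 4)))) ;;
     Count ''j'' ''m''
       (Assign ''u'' (Plus (Plus (Cell ''n'') (Const 4)) (Plus (Cell ''j'') (Plus (Cell ''j'') (Cell ''j'')))) ;;
        Assign ''b'' (Read ''in'' (Cell ''u'')) ;;
        Store ''as'' (Cell ''j'') (Cell ''b'') ;;
        Store ''tl'' (Cell ''b'') (Read ''in'' (Plus (Cell ''u'') (Const 1))) ;;
        Store ''hd'' (Cell ''b'') (Read ''in'' (Plus (Cell ''u'') (Const 2))))"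

lemma concat_triples_nth:
  assumes "j < length as" "r < 3"
  shows "concat (map (\<lambda>a. [f a, g a, h a]) as) ! (3 * j + r) = [f (as ! j), g (as ! j), h (as ! j)] ! r"
  using assms
proof (induction as arbitrary: j)
  case (Cons a as)
  show ?case
  proof (cases j)
    case 0
    then show ?thesis using Cons.prems by (simp add: nth_Cons split: nat.split)
  next
    case (Suc i)
    then have "3 * j + r = Suc (Suc (Suc (3 * i + r)))" by simp
    then show ?thesis using Cons Suc by simp
  qed
qed simp

context coded_digraph
begin

definition input :: "nat list" where
  "input = k # [length vs, length as] @ vs @ concat (map (\<lambda>a. [a, tail D a, head D a]) as)"

text \<open>Cell 0 holds the length of the list, which shifts all positions by one.\<close>

lemma input_nth:
  "initial_memory input ''in'' 1 = k"
  "initial_memory input ''in'' 2 = length vs"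
  "initial_memory input ''in'' 3 = length as"
  "i < length vs \<Longrightarrow> initial_memory input ''in'' (i + 4) = vs ! i"
  "j < length as \<Longrightarrow> r < 3 \<Longrightarrow>
     initial_memory input ''in'' (length vs + 4 + 3 * j + r) = [as ! j, tail D (as ! j), head D (as ! j)] ! r"
proof -
  let ?c = "concat (map (\<lambda>a. [a, tail D a, head D a]) as)"
  have len: "length ?c = 3 * length as" by (induction as) auto
  show "initial_memory input ''in'' 1 = k" "initial_memory input ''in'' 2 = length vs"
    "initial_memory input ''in'' 3 = length as"
    by (simp_all add: initial_memory_def input_def numeral_eq_Suc)
  show "initial_memory input ''in'' (i + 4) = vs ! i" if "i < length vs"
    using that by (simp add: initial_memory_def input_def numeral_eq_Suc nth_append)
  show "initial_memory input ''in'' (length vs + 4 + 3 * j + r) = [as ! j, tail D (as ! j), head D (as ! j)] ! r"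
    if "j < length as" "r < 3"
  proof -
    have "3 * j + r < length ?c" using that len by simp
    moreover have "input ! (length vs + 3 + (3 * j + r)) = ?c ! (3 * j + r)"
      by (simp add: input_def numeral_eq_Suc nth_append)
    moreover have "?c ! (3 * j + r) = [as ! j, tail D (as ! j), head D (as ! j)] ! r"
      by (rule concat_triples_nth[OF that])
    ultimately show ?thesis using len by (simp add: initial_memory_def input_def add_ac)
  qed
qed

lemma load:
  shows "result load (initial_memory input) ''k'' 0 = k"
    "result load (initial_memory input) ''n'' 0 = length vs"
    "result load (initial_memory input) ''m'' 0 = length as"
    "x \<notin> {''k'', ''n'', ''m''} \<Longrightarrow> result load (initial_memory input) x = initial_memory input x"
  using input_nth(1-3) by (simp_all add: load_def)

text \<open>Memory outside the input is 0 at the start, so all arcs are uncovered with level 0 and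
  the scan position is 0.\<close>

lemma scan_invariant_initial:
  defines "s \<equiv> result unpack (result load (initial_memory input))"
  shows "scan_invariant s" "scan_measure s \<le> length as * (2 * length as + 1) * Suc (length as) + length as"
proof -
  define s0 where "s0 = result load (initial_memory input)"
  define P where "P = Store ''vs'' (Cell ''v'') (Read ''in'' (Plus (Cell ''v'') (Const 4)))"
  define Q where "Q = Assign ''u'' (Plus (Plus (Cell ''n'') (Const 4)) (Plus (Cell ''j'') (Plus (Cell ''j'') (Cell ''j'')))) ;;
        Assign ''b'' (Read ''in'' (Cell ''u'')) ;;
        Store ''as'' (Cell ''j'') (Cell ''b'') ;;
        Store ''tl'' (Cell ''b'') (Read ''in'' (Plus (Cell ''u'') (Const 1))) ;;
        Store ''hd'' (Cell ''b'') (Read ''in'' (Plus (Cell ''u'') (Const 2)))"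
  define s1 where "s1 = result (Count ''v'' ''n'' P) s0"
  have s: "s = result (Count ''j'' ''m'' Q) s1"
    by (simp only: s_def unpack_def P_def Q_def s1_def s0_def result.simps(3))
  have fr0: "s0 x = initial_memory input x" if "x \<notin> {''k'', ''n'', ''m''}" for x
    unfolding s0_def by (rule load(4)[OF that])
  have fr1: "s1 x = s0 x" if "x \<notin> {''v'', ''vs''}" for x
    unfolding s1_def by (rule result_frame) (use that in \<open>simp add: P_def\<close>)
  have W: "writes Q = {''u'', ''b'', ''as'', ''tl'', ''hd''}" by (auto simp: Q_def)
  have fr: "s x = s1 x" if "x \<notin> {''j'', ''u'', ''b'', ''as'', ''tl'', ''hd''}" for x
    unfolding s by (rule result_frame) (use that in \<open>simp add: W\<close>)
  have dims: "s1 ''k'' 0 = k" "s1 ''n'' 0 = length vs" "s1 ''m'' 0 = length as"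
    using fr1[of "''k''"] fr1[of "''n''"] fr1[of "''m''"] load(1-3) by (simp_all add: s0_def)
  let ?I = "\<lambda>j t. \<forall>i<j. t ''vs'' i = vs ! i"
  have "?I (s0 ''n'' 0) s1"
    unfolding s1_def
  proof (rule result_Count[where I = ?I], goal_cases)
    case (6 j t)
    have "t ''in'' = initial_memory input ''in''" using 6(4)[of "''in''"] fr0[of "''in''"] by (simp add: P_def)
    moreover have "j < length vs" using 6(1) load(2) by (simp add: s0_def)
    ultimately show ?case using 6(2,3) input_nth(4) by (simp add: P_def less_Suc_eq)
  qed (simp_all add: P_def)
  then have vs: "\<forall>i<length vs. s1 ''vs'' i = vs ! i" using load(2) by (simp add: s0_def)
  let ?J = "\<lambda>j t. \<forall>i<j. t ''as'' i = as ! i \<and> t ''tl'' (as ! i) = tail D (as ! i) \<and>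
    t ''hd'' (as ! i) = head D (as ! i)"
  have "?J (s1 ''m'' 0) s"
    unfolding s
  proof (rule result_Count[where I = ?J], goal_cases)
    case (6 j t)
    have t: "t ''in'' = initial_memory input ''in''" "t ''n'' 0 = length vs"
      using 6(4)[of "''in''"] 6(4)[of "''n''"] fr1[of "''in''"] fr0[of "''in''"] dims
      unfolding W by simp_all
    have j: "j < length as" using 6(1) dims by simp
    define u where "u = length vs + 4 + 3 * j"
    have "t ''in'' u = as ! j" "t ''in'' (u + 1) = tail D (as ! j)" "t ''in'' (u + 2) = head D (as ! j)"
      using input_nth(5)[OF j, of 0] input_nth(5)[OF j, of 1] input_nth(5)[OF j, of 2]
      unfolding t u_def by simp_all
    moreover have "result (Assign ''u'' (Plus (Plus (Cell ''n'') (Const 4))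
        (Plus (Cell ''j'') (Plus (Cell ''j'') (Cell ''j''))))) t = store ''u'' 0 u t"
    proof -
      have "length vs + 4 + (j + (j + j)) = u" by (simp add: u_def)
      then show ?thesis using t(2) by (simp only: result.simps(2) expr_val.simps 6(3))
    qed
    then have "result Q t = result (Assign ''b'' (Read ''in'' (Cell ''u'')) ;;
        Store ''as'' (Cell ''j'') (Cell ''b'') ;;
        Store ''tl'' (Cell ''b'') (Read ''in'' (Plus (Cell ''u'') (Const 1))) ;;
        Store ''hd'' (Cell ''b'') (Read ''in'' (Plus (Cell ''u'') (Const 2)))) (store ''u'' 0 u t)"
      unfolding Q_def by (simp only: result.simps(3))
    ultimately have
      "result Q t ''as'' = (t ''as'')(j := as ! j)"
      "result Q t ''tl'' = (t ''tl'')(as ! j := tail D (as ! j))"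
      "result Q t ''hd'' = (t ''hd'')(as ! j := head D (as ! j))"
      by (simp_all add: 6(3))
    then show ?case using 6(2) by (auto simp: less_Suc_eq)
  qed (simp_all add: W)
  then have J: "\<forall>i<length as. s ''as'' i = as ! i \<and> s ''tl'' (as ! i) = tail D (as ! i) \<and>
    s ''hd'' (as ! i) = head D (as ! i)" using dims by simp
  have st: "static s"
    unfolding static_def
  proof (intro conjI ballI)
    show "s ''k'' 0 = k" "s ''n'' 0 = length vs" "s ''m'' 0 = length as"
      "\<forall>i<length vs. s ''vs'' i = vs ! i" "\<forall>j<length as. s ''as'' j = as ! j"
      using fr[of "''k''"] fr[of "''n''"] fr[of "''m''"] fr[of "''vs''"] dims vs J by simp_all
    fix a assume "a \<in> arcs D"
    then obtain i where "i < length as" "as ! i = a" unfolding set_as[symmetric] in_set_conv_nth by blast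
    then show "s ''tl'' a = tail D a" "s ''hd'' a = head D a" using J by blast+
  qed
  have zero: "s x i = 0" if "x \<in> {''col'', ''lev'', ''e''}" for x i
    using that fr[of x] fr1[of x] fr0[of x] by (auto simp: initial_memory_def)
  show "scan_invariant s"
    unfolding scan_invariant_def using st zero by (simp add: part.valid_initial)
  show "scan_measure s \<le> length as * (2 * length as + 1) * Suc (length as) + length as"
    unfolding scan_measure_def length_as using zero by (simp add: part.potential_initial)
qed

end

section \<open>The complete program\<close>

text \<open>For \<open>k = 0\<close> the empty list is a packing whatever the number of vertices, so
  the test for three vertices is made only for positive \<open>k\<close>.\<close>

definition feasible :: cond where
  "feasible = Conj (Neg (Less (Cell ''m'') (Cell ''k'')))
     (Neg (Conj (Less (Const 0) (Cell ''k'')) (Less (Cell ''n'') (Const 3))))"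

definition packing_program :: program where
  "packing_program = Seq (compile load)
     (Branch feasible
       (Seq (compile unpack)
         (Seq (While (Less (Cell ''e'') (Cell ''m'')) (compile scan_arc)) (compile finish)))
       (compile reject))"

text \<open>\<open>N\<close> stands for a bound on the length of the input list. The factor before
  \<open>cost N scan_arc + 1\<close> bounds the initial \<open>scan_measure\<close>, and the last
  summand covers reading the output.\<close>

definition time_bound :: "nat \<Rightarrow> nat" where
  "time_bound N = cost N load + 1 + cost N reject + cost N unpack +
     (1 + (N * (2 * N + 1) * (N + 1) + N) * (cost N scan_arc + 1)) + cost N finish +
     (2 + N * (2 + N + 3 * N))"

lemma program_bounds:
  "counters_fixed load" "counters_fixed unpack" "counters_fixed scan_arc" "counters_fixed finish"
  "counters_fixed reject" "bounds load = {}" "bounds unpack \<subseteq> {''n'', ''m'', ''k''}"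
  "bounds scan_arc \<subseteq> {''n'', ''m'', ''k''}" "bounds finish \<subseteq> {''n'', ''m'', ''k''}" "bounds reject = {}"
  "writes unpack \<inter> {''n'', ''m'', ''k''} = {}" "writes scan_arc \<inter> {''n'', ''m'', ''k''} = {}"
  "writes finish \<inter> {''n'', ''m'', ''k''} = {}"
  by (simp_all add: load_def unpack_def writes_simps finish_simps)

section \<open>Polynomiality of the time bound\<close>

definition poly_fun :: "(nat \<Rightarrow> nat) \<Rightarrow> bool" where
  "poly_fun f \<longleftrightarrow> (\<exists>p. \<forall>N. poly p N = f N)"

lemma poly_fun_const: "poly_fun (\<lambda>N. c)"
  unfolding poly_fun_def by (intro exI[of _ "[:c:]"]) simp

lemma poly_fun_id: "poly_fun (\<lambda>N. N)"
  unfolding poly_fun_def by (intro exI[of _ "[:0, 1:]"]) simp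

lemma poly_fun_add: "poly_fun f \<Longrightarrow> poly_fun g \<Longrightarrow> poly_fun (\<lambda>N. f N + g N)"
  unfolding poly_fun_def by (metis poly_add)

lemma poly_fun_mult: "poly_fun f \<Longrightarrow> poly_fun g \<Longrightarrow> poly_fun (\<lambda>N. f N * g N)"
  unfolding poly_fun_def by (metis poly_mult)

text \<open>For a fixed program, \<open>cost\<close> is built from \<open>N\<close> and constants by
  sums and products.\<close>

lemma poly_fun_cost: "poly_fun (\<lambda>N. cost N P)"
  by (induction P) (simp_all only: cost.simps, (intro poly_fun_const poly_fun_add poly_fun_mult poly_fun_id | assumption)+)

lemma poly_fun_time_bound: "poly_fun time_bound"
  unfolding time_bound_def
  by (intro poly_fun_const poly_fun_add poly_fun_mult poly_fun_id poly_fun_cost)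

lemma length_le_input_size: "length xs \<le> input_size xs"
  unfolding input_size_def by (induction xs) auto

context coded_digraph
begin

lemma feasible_iff:
  "cond_val feasible (result load (initial_memory input)) \<longleftrightarrow> k \<le> length as \<and> (0 < k \<longrightarrow> 3 \<le> length vs)"
  using load(1-3) by (auto simp: feasible_def)

lemma packing_program_correct:
  assumes N: "length input \<le> N"
  shows "\<exists>ys. computes_within packing_program input (time_bound N) ys \<and>
    ((\<exists>Hs cs. antistrong_packing D k Hs \<and> list_all2 digraph_code Hs cs \<and> ys = 1 # concat cs) \<or>
     (ys = [0] \<and> \<not> (\<exists>Hs. antistrong_packing D k Hs)))"
proof -
  let ?s0 = "initial_memory input"
  define s1 where "s1 = result load ?s0"
  obtain t1 where t1: "t1 \<le> cost N load" "exec (compile load) ?s0 t1 s1"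
    using exec_compile[of load ?s0 N] program_bounds unfolding s1_def by auto
  show ?thesis
  proof (cases "cond_val feasible s1")
    case False
    obtain t2 where t2: "t2 \<le> cost N reject" "exec (compile reject) s1 t2 (result reject s1)"
      using exec_compile[of reject s1 N] program_bounds by auto
    have "exec packing_program ?s0 (t1 + (1 + t2)) (result reject s1)"
      unfolding packing_program_def by (rule exec.Seq[OF t1(2) exec.Branch_False[OF False t2(2)]])
    moreover have "t1 + (1 + t2) + length [0] \<le> time_bound N"
      using t1(1) t2(1) by (simp add: time_bound_def)
    ultimately have "computes_within packing_program input (time_bound N) [0]"
      unfolding computes_within_def using output_list_reject by metis
    moreover have "\<not> antistrong_packing D k Hs" for Hs
    proof
      assume "antistrong_packing D k Hs"
      then show False
        using False packing_bounds[of Hs] unfolding s1_def feasible_iff by (cases "k = 0") auto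
    qed
    ultimately show ?thesis by blast
  next
    case True
    then have k: "k \<le> length as" "0 < k \<Longrightarrow> 3 \<le> length vs" unfolding s1_def feasible_iff by blast+
    have "length vs + 3 * length as \<le> length input"
      using length_concat[of "map (\<lambda>a. [a, tail D a, head D a]) as"]
      by (simp add: input_def comp_def sum_list_triv)
    \<comment> \<open>The bound on \<open>k\<close> comes from the feasibility test, not from the
      length of the input.\<close>
    then have nm: "length vs \<le> N" "length as \<le> N" "k \<le> N" using N k by simp_all
    have small: "s b 0 \<le> N" if "static s" "b \<in> {''n'', ''m'', ''k''}" for s b
      using that nm by (auto simp: static_def)
    have small1: "s1 b 0 \<le> N" if "b \<in> {''n'', ''m'', ''k''}" for b
      using that nm load(1-3) unfolding s1_def by auto
    define s2 where "s2 = result unpack s1"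
    obtain t2 where t2: "t2 \<le> cost N unpack" "exec (compile unpack) s1 t2 s2"
      using exec_compile_subset[OF program_bounds(2,7,11), of s1 N] small1 unfolding s2_def by blast
    have inv: "scan_invariant s2" "scan_measure s2 \<le> N * (2 * N + 1) * (N + 1) + N"
    proof -
      show "scan_invariant s2" unfolding s2_def s1_def by (rule scan_invariant_initial)
      have "scan_measure s2 \<le> length as * (2 * length as + 1) * Suc (length as) + length as"
        unfolding s2_def s1_def by (rule scan_invariant_initial)
      also have "\<dots> \<le> N * (2 * N + 1) * (N + 1) + N"
        using nm by (intro add_mono mult_le_mono) simp_all
      finally show "scan_measure s2 \<le> N * (2 * N + 1) * (N + 1) + N" .
    qed
    have "\<exists>t s'. exec (compile scan_arc) s t s' \<and> t \<le> cost N scan_arc \<and> scan_invariant s' \<and>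
        scan_measure s' < scan_measure s"
      if s: "scan_invariant s" "cond_val (Less (Cell ''e'') (Cell ''m'')) s" for s
    proof -
      have st: "static s" using s by (simp add: scan_invariant_def)
      obtain t where "t \<le> cost N scan_arc" "exec (compile scan_arc) s t (result scan_arc s)"
        using exec_compile_subset[OF program_bounds(3,8,12), of s N] small[OF st] by blast
      moreover have "s ''e'' 0 < length as" using s st by (simp add: static_def)
      ultimately show ?thesis using scan_arc[OF s(1)] by blast
    qed
    from exec_While_measure[of scan_invariant, OF this inv(1)]
    obtain t3 s3 where t3: "exec (While (Less (Cell ''e'') (Cell ''m'')) (compile scan_arc)) s2 t3 s3"
        "t3 \<le> 1 + scan_measure s2 * (cost N scan_arc + 1)" and s3: "scan_invariant s3"
        "\<not> cond_val (Less (Cell ''e'') (Cell ''m'')) s3"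
      by blast
    have st3: "static s3" using s3 by (simp add: scan_invariant_def)
    obtain t4 where t4: "t4 \<le> cost N finish" "exec (compile finish) s3 t4 (result finish s3)"
      using exec_compile_subset[OF program_bounds(4,9,13), of s3 N] small[OF st3] by blast
    define ys where "ys = output_list (result finish s3)"
    have exec: "exec packing_program ?s0 (t1 + (1 + (t2 + (t3 + t4)))) (result finish s3)"
      unfolding packing_program_def
      by (rule exec.Seq[OF t1(2) exec.Branch_True[OF True exec.Seq[OF t2(2) exec.Seq[OF t3(1) t4(2)]]]])
    have "scan_measure s2 * (cost N scan_arc + 1) \<le>
        (N * (2 * N + 1) * (N + 1) + N) * (cost N scan_arc + 1)"
      using inv(2) by (rule mult_le_mono1)
    then have time: "t1 + (1 + (t2 + (t3 + t4))) + length ys \<le> time_bound N"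
      if "length ys \<le> 1 + N * (2 + N + 3 * N)"
      using that t1(1) t2(1) t3(2) t4(1) unfolding time_bound_def by linarith
    have v: "part.valid k (s3 ''col'') (s3 ''lev'')" using s3(1) by (simp add: scan_invariant_def)
    \<comment> \<open>When the loop ends, the scan position has passed all arcs, so the scan
      invariant speaks about each of them.\<close>
    have stuck: "card (arcs D) \<le> s3 ''lev'' a" if a: "a \<in> arcs D" "s3 ''col'' a = 0" for a
    proof -
      obtain j where j: "j < length as" "as ! j = a"
        using a(1) unfolding set_as[symmetric] in_set_conv_nth by blast
      moreover have "length as \<le> s3 ''e'' 0" using s3(2) st3 by (simp add: static_def)
      ultimately show ?thesis using s3(1) a(2) length_as by (auto simp: scan_invariant_def)
    qed
    show ?thesis
    proof (cases "\<forall>i\<in>{1..k}. bip_connected D (part.colour_class (s3 ''col'') i)")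
      case conn: True
      have ys: "ys = classes_code (s3 ''col'') k"
        unfolding ys_def by (rule finish_yes[OF st3 conn])
      have "length ys \<le> 1 + k * (2 + length vs + 3 * length as)"
        unfolding ys by (rule length_classes_code)
      also have "\<dots> \<le> 1 + N * (2 + N + 3 * N)"
        using nm by (intro add_mono mult_le_mono) simp_all
      finally have "computes_within packing_program input (time_bound N) ys"
        unfolding computes_within_def using time exec ys_def by blast
      moreover have "antistrong_packing D k (class_digraphs (s3 ''col''))"
        using conn k(2) by (intro class_digraphs_packing) blast+
      ultimately show ?thesis using class_digraphs_code ys unfolding classes_code_def by blast
    next
      case disc: False
      have ys: "ys = [0]" unfolding ys_def by (rule finish_no[OF st3 disc])
      then have "length ys \<le> 1 + N * (2 + N + 3 * N)" by simp
      then have "computes_within packing_program input (time_bound N) ys"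
        unfolding computes_within_def using time exec ys_def by blast
      \<comment> \<open>Any packing would force all final classes to be connected, contrary to the
        failed check.\<close>
      moreover have "\<not> antistrong_packing D k Hs" for Hs
        using disc packing_imp_connected[OF _ v stuck] by blast
      ultimately show ?thesis using ys by blast
    qed
  qed
qed

end

theorem theorem3p5:
  shows "\<exists>(P :: program) (p :: nat poly).
    \<forall>(D :: (nat, nat) pre_digraph) (k :: nat) (xs :: nat list).
      fin_digraph D \<longrightarrow> loopfree_digraph D \<longrightarrow> digraph_code D xs \<longrightarrow>
      (\<exists>ys. computes_within P (k # xs) (poly p (input_size (k # xs))) ys \<and>
        ((\<exists>Hs cs. antistrong_packing D k Hs \<and> list_all2 digraph_code Hs cs \<and>
            ys = 1 # concat cs) \<or>
         (ys = [0] \<and> \<not> (\<exists>Hs. antistrong_packing D k Hs))))"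
proof -
  obtain p where p: "\<And>N. poly p N = time_bound N"
    using poly_fun_time_bound unfolding poly_fun_def by blast
  show ?thesis
  proof (intro exI[of _ packing_program] exI[of _ p] allI impI)
    fix D :: "(nat, nat) pre_digraph" and k xs
    assume D: "fin_digraph D" and "digraph_code D xs"
    then obtain vs as where code: "distinct vs" "set vs = verts D" "distinct as" "set as = arcs D"
        "xs = [length vs, length as] @ vs @ concat (map (\<lambda>a. [a, tail D a, head D a]) as)"
      unfolding digraph_code_def by blast
    interpret coded_digraph D k vs as
      using D code by (intro coded_digraph.intro) (simp_all add: fin_digraph_def)
    have "k # xs = input" using code(5) by (simp add: input_def)
    then show "\<exists>ys. computes_within packing_program (k # xs) (poly p (input_size (k # xs))) ys \<and>
        ((\<exists>Hs cs. antistrong_packing D k Hs \<and> list_all2 digraph_code Hs cs \<and>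
            ys = 1 # concat cs) \<or>
         (ys = [0] \<and> \<not> (\<exists>Hs. antistrong_packing D k Hs)))"
      \<comment> \<open>Each number contributes at least 1 to the input size, so the input size may
        serve as \<open>N\<close>.\<close>
      using packing_program_correct[OF length_le_input_size] unfolding p by simp
  qed
qed

end
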